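(* Let $n\ge 1$ be an integer. For $l \ge 1$ let $\mathcal{R}_l$ be the finite set of group presentations $\langle x_1,\dots,x_{n+1}\mid r_1,\dots,r_n\rangle$ in which each $r_i$ is a non-empty cyclically reduced word of length at most $l$ in the alphabet $\{x_1^{\pm1},\dots,x_{n+1}^{\pm1}\}$. Then a random group of deficiency 1 (in this few-relator model) is free-by-cyclic with asymptotic probability bounded away from 1, i.e. $$\limsup_{l\to\infty}\frac{\#\{\text{presentations in }\mathcal{R}_l\text{ whose group is free-by-cyclic}\}}{\#\mathcal{R}_l}<1 .$$
   Context: A group is free-by-cyclic if it is isomorphic to a semidirect product $F\rtimes\mathbb{Z}$ with $F$ a free group of finite rank. Presentations in $\mathcal{R}_l$ are identified with ordered $n$-tuples $(r_1,\dots,r_n)$ of words. *)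

theory Defs
  imports "HOL-Algebra.Generated_Groups" "HOL-Algebra.Bij" "HOL-Algebra.Elementary_Groups"
    "HOL-Library.Extended_Real" "HOL-Library.Liminf_Limsup"
begin

text \<open>The pair \<open>(x, True)\<close> stands for the generator \<open>x\<close> and \<open>(x, False)\<close> for its formal inverse.\<close>

type_synonym 'a letter = "'a \<times> bool"
type_synonym 'a word = "'a letter list"

definition inv_letter :: "'a letter \<Rightarrow> 'a letter" where
  "inv_letter a = (fst a, \<not> snd a)"

definition reduced :: "'a word \<Rightarrow> bool" where
  "reduced w \<longleftrightarrow> successively (\<lambda>a b. b \<noteq> inv_letter a) w"

definition cyclically_reduced :: "'a word \<Rightarrow> bool" where
  "cyclically_reduced w \<longleftrightarrow> reduced w \<and> (w \<noteq> [] \<longrightarrow> hd w \<noteq> inv_letter (last w))"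

definition words_over :: "'a set \<Rightarrow> 'a word set" where
  "words_over X = lists (X \<times> UNIV)"

fun cancel_cons :: "'a letter \<Rightarrow> 'a word \<Rightarrow> 'a word" where
  "cancel_cons a [] = [a]"
| "cancel_cons a (b # w) = (if b = inv_letter a then w else a # b # w)"

definition reduce :: "'a word \<Rightarrow> 'a word" where
  "reduce w = foldr cancel_cons w []"

definition free_group :: "'a set \<Rightarrow> 'a word monoid" where
  "free_group X =
     \<lparr>carrier = {w \<in> words_over X. reduced w}, mult = (\<lambda>u v. reduce (u @ v)), one = []\<rparr>"

lemma inv_letter_inv_letter [simp]: "inv_letter (inv_letter a) = a"
  by (simp add: inv_letter_def)

lemma inv_letter_neq [simp]: "inv_letter a \<noteq> a" "a \<noteq> inv_letter a"
  by (auto simp: inv_letter_def prod_eq_iff)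

lemma fst_inv_letter [simp]: "fst (inv_letter a) = fst a"
  by (simp add: inv_letter_def)

lemma reduced_Nil [simp]: "reduced []"
  by (simp add: reduced_def)

lemma reduced_Cons: "reduced (a # w) \<longleftrightarrow> reduced w \<and> (w \<noteq> [] \<longrightarrow> hd w \<noteq> inv_letter a)"
  by (cases w) (auto simp: reduced_def)

lemma reduced_cancel_cons: "reduced w \<Longrightarrow> reduced (cancel_cons a w)"
  by (cases w) (auto simp: reduced_Cons)

lemma cancel_cons_inv: "reduced w \<Longrightarrow> cancel_cons (inv_letter a) (cancel_cons a w) = w"
  by (cases w; cases "tl w") (auto simp: reduced_Cons)

lemma reduced_foldr: "reduced w \<Longrightarrow> reduced (foldr cancel_cons u w)"
  by (induction u) (auto simp: reduced_cancel_cons)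

lemma reduced_reduce [simp]: "reduced (reduce w)"
  by (simp add: reduce_def reduced_foldr)

lemma reduce_reduced: "reduced w \<Longrightarrow> reduce w = w"
proof (induction w)
  case (Cons a w)
  then show ?case by (cases w) (auto simp: reduced_Cons reduce_def)
qed (simp add: reduce_def)

lemma foldr_cancel_cons:
  assumes "reduced w"
  shows "foldr cancel_cons (cancel_cons a u) w = cancel_cons a (foldr cancel_cons u w)"
proof (cases u)
  case (Cons b v)
  have "reduced (foldr cancel_cons v w)" using assms by (rule reduced_foldr)
  then show ?thesis using Cons cancel_cons_inv[of "foldr cancel_cons v w" "inv_letter a"] by auto
qed simp

lemma foldr_reduce: "reduced w \<Longrightarrow> foldr cancel_cons (reduce u) w = foldr cancel_cons u w"
  by (induction u) (simp_all add: reduce_def foldr_cancel_cons)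

lemma reduce_append: "reduce (u @ v) = foldr cancel_cons u (reduce v)"
  by (simp add: reduce_def)

lemma reduce_append_left: "reduce (reduce u @ v) = reduce (u @ v)"
  by (simp add: reduce_append foldr_reduce)

lemma reduce_append_right: "reduce (u @ reduce v) = reduce (u @ v)"
  by (simp add: reduce_append reduce_reduced)

lemma words_over_Cons [simp]: "a # w \<in> words_over X \<longleftrightarrow> fst a \<in> X \<and> w \<in> words_over X"
  by (cases a) (auto simp: words_over_def)

lemma in_words_over_iff: "w \<in> words_over X \<longleftrightarrow> (\<forall>a \<in> set w. fst a \<in> X)"
  by (induction w) (simp_all add: words_over_def mem_Times_iff)

lemma words_over_Nil [simp]: "[] \<in> words_over X"
  by (simp add: words_over_def)

lemma words_over_append [simp]:
  "u @ v \<in> words_over X \<longleftrightarrow> u \<in> words_over X \<and> v \<in> words_over X"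
  by (simp add: words_over_def)

lemma words_over_cancel_cons:
  "fst a \<in> X \<Longrightarrow> w \<in> words_over X \<Longrightarrow> cancel_cons a w \<in> words_over X"
  by (cases w) auto

lemma words_over_reduce: "w \<in> words_over X \<Longrightarrow> reduce w \<in> words_over X"
  by (induction w) (auto simp: reduce_def words_over_cancel_cons)

lemma reduce_rev_inv: "reduced w \<Longrightarrow> foldr cancel_cons (map inv_letter (rev u) @ u) w = w"
proof (induction u arbitrary: w)
  case (Cons a u)
  have "reduced (foldr cancel_cons u w)" using Cons.prems by (rule reduced_foldr)
  then show ?case using Cons by (simp add: cancel_cons_inv)
qed simp

lemma group_free_group: "group (free_group X)"
proof (rule groupI)
  fix x y z
  assume "x \<in> carrier (free_group X)" "y \<in> carrier (free_group X)" "z \<in> carrier (free_group X)"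
  show "x \<otimes>\<^bsub>free_group X\<^esub> y \<otimes>\<^bsub>free_group X\<^esub> z =
        x \<otimes>\<^bsub>free_group X\<^esub> (y \<otimes>\<^bsub>free_group X\<^esub> z)"
    by (simp add: free_group_def reduce_append_left reduce_append_right)
next
  fix x assume x: "x \<in> carrier (free_group X)"
  have "reduce (map inv_letter (rev x)) \<otimes>\<^bsub>free_group X\<^esub> x = \<one>\<^bsub>free_group X\<^esub>"
    using reduce_rev_inv[of "[]" x]
    by (simp only: free_group_def reduce_append_left monoid.simps reduced_Nil) (simp add: reduce_def)
  moreover have "map inv_letter (rev x) \<in> words_over X"
    using x by (simp add: free_group_def in_words_over_iff)
  then have "reduce (map inv_letter (rev x)) \<in> carrier (free_group X)"
    by (simp add: free_group_def words_over_reduce)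
  ultimately show "\<exists>y\<in>carrier (free_group X). y \<otimes>\<^bsub>free_group X\<^esub> x = \<one>\<^bsub>free_group X\<^esub>"
    by blast
qed (auto simp: free_group_def words_over_reduce reduce_reduced)

definition normal_closure :: "('a, 'b) monoid_scheme \<Rightarrow> 'a set \<Rightarrow> 'a set" where
  "normal_closure G S =
     generate G {g \<otimes>\<^bsub>G\<^esub> s \<otimes>\<^bsub>G\<^esub> inv\<^bsub>G\<^esub> g | g s. g \<in> carrier G \<and> s \<in> S}"

lemma (in group) normal_closure_normal:
  assumes S: "S \<subseteq> carrier G"
  shows "normal_closure G S \<lhd> G"
  unfolding normal_closure_def
proof (rule normal_generateI)
  show "{g \<otimes> s \<otimes> inv g | g s. g \<in> carrier G \<and> s \<in> S} \<subseteq> carrier G"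
    using S by auto
next
  fix h k assume "h \<in> {g \<otimes> s \<otimes> inv g | g s. g \<in> carrier G \<and> s \<in> S}" and k: "k \<in> carrier G"
  then obtain g s where gs: "h = g \<otimes> s \<otimes> inv g" "g \<in> carrier G" "s \<in> S"
    by blast
  moreover have "s \<in> carrier G" using gs S by blast
  ultimately have "k \<otimes> h \<otimes> inv k = (k \<otimes> g) \<otimes> s \<otimes> inv (k \<otimes> g)"
    using k by (simp add: m_assoc inv_mult_group)
  then show "k \<otimes> h \<otimes> inv k \<in> {g \<otimes> s \<otimes> inv g | g s. g \<in> carrier G \<and> s \<in> S}"
    using gs k by blast
qed

lemma (in group) normal_closure_superset:
  assumes "S \<subseteq> carrier G"
  shows "S \<subseteq> normal_closure G S"
proof
  fix s assume s: "s \<in> S"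
  have "s = \<one> \<otimes> s \<otimes> inv \<one>" using s assms by auto
  then show "s \<in> normal_closure G S"
    unfolding normal_closure_def using s by (intro generate.incl) blast
qed

lemma (in group) normal_closure_minimal:
  assumes "N \<lhd> G" "S \<subseteq> N"
  shows "normal_closure G S \<subseteq> N"
  unfolding normal_closure_def
proof (rule generate_subgroup_incl)
  show "subgroup N G" using assms(1) by (rule normal_imp_subgroup)
  show "{g \<otimes> s \<otimes> inv g | g s. g \<in> carrier G \<and> s \<in> S} \<subseteq> N"
    using normal.inv_op_closed2[OF assms(1)] assms(2) by auto
qed

definition presented_group :: "'a set \<Rightarrow> 'a word set \<Rightarrow> 'a word set monoid" where
  "presented_group X R = free_group X Mod normal_closure (free_group X) R"

text \<open>The automorphism \<open>\<phi> h\<close> acts on \<open>N\<close> from the left.\<close>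

definition semidirect_product ::
  "('a, 'c) monoid_scheme \<Rightarrow> ('b, 'd) monoid_scheme \<Rightarrow> ('b \<Rightarrow> 'a \<Rightarrow> 'a) \<Rightarrow> ('a \<times> 'b) monoid" where
  "semidirect_product N H \<phi> =
     \<lparr>carrier = carrier N \<times> carrier H,
      mult = (\<lambda>(a, h) (b, k). (a \<otimes>\<^bsub>N\<^esub> \<phi> h b, h \<otimes>\<^bsub>H\<^esub> k)),
      one = (\<one>\<^bsub>N\<^esub>, \<one>\<^bsub>H\<^esub>)\<rparr>"

lemma group_semidirect_product:
  assumes N: "group N" and H: "group H" and \<phi>: "\<phi> \<in> hom H (AutoGroup N)"
  shows "group (semidirect_product N H \<phi>)"
proof -
  interpret N: group N by fact
  interpret H: group H by fact
  have aut: "\<phi> h \<in> hom N N" "\<phi> h \<in> Bij (carrier N)" if "h \<in> carrier H" for h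
    using \<phi> that by (auto simp: hom_def AutoGroup_def auto_def)
  have closed: "\<phi> h a \<in> carrier N" if "h \<in> carrier H" "a \<in> carrier N" for h a
    using aut(1)[OF that(1)] that(2) by (auto simp: hom_def)
  have mult: "\<phi> h (a \<otimes>\<^bsub>N\<^esub> b) = \<phi> h a \<otimes>\<^bsub>N\<^esub> \<phi> h b"
    if "h \<in> carrier H" "a \<in> carrier N" "b \<in> carrier N" for h a b
    using aut(1)[OF that(1)] that by (auto simp: hom_def)
  have comp: "\<phi> (h \<otimes>\<^bsub>H\<^esub> k) a = \<phi> h (\<phi> k a)"
    if "h \<in> carrier H" "k \<in> carrier H" "a \<in> carrier N" for h k a
  proof -
    have "\<phi> (h \<otimes>\<^bsub>H\<^esub> k) = \<phi> h \<otimes>\<^bsub>AutoGroup N\<^esub> \<phi> k"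
      using \<phi> that by (auto simp: hom_def)
    then show ?thesis
      using that aut by (simp add: AutoGroup_def BijGroup_def compose_def)
  qed
  have one: "\<phi> \<one>\<^bsub>H\<^esub> a = a" if "a \<in> carrier N" for a
  proof -
    have "\<phi> \<one>\<^bsub>H\<^esub> = \<one>\<^bsub>AutoGroup N\<^esub>"
      using hom_one[OF \<phi> H N.AutoGroup] .
    then show ?thesis using that by (simp add: AutoGroup_def BijGroup_def)
  qed
  show ?thesis
  proof (rule groupI)
    fix x assume x: "x \<in> carrier (semidirect_product N H \<phi>)"
    obtain a h where [simp]: "x = (a, h)" by (cases x)
    have ah: "a \<in> carrier N" "h \<in> carrier H" using x by (auto simp: semidirect_product_def)
    have "\<phi> (inv\<^bsub>H\<^esub> h) (inv\<^bsub>N\<^esub> a) \<otimes>\<^bsub>N\<^esub> \<phi> (inv\<^bsub>H\<^esub> h) a = \<phi> (inv\<^bsub>H\<^esub> h) \<one>\<^bsub>N\<^esub>"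
      using ah by (simp flip: mult)
    also have "\<dots> = \<one>\<^bsub>N\<^esub>"
      using ah by (intro hom_one[OF aut(1) N N]) auto
    finally show "\<exists>y\<in>carrier (semidirect_product N H \<phi>).
        y \<otimes>\<^bsub>semidirect_product N H \<phi>\<^esub> x = \<one>\<^bsub>semidirect_product N H \<phi>\<^esub>"
      using ah closed
      by (intro bexI[of _ "(\<phi> (inv\<^bsub>H\<^esub> h) (inv\<^bsub>N\<^esub> a), inv\<^bsub>H\<^esub> h)"]) (auto simp: semidirect_product_def)
  qed (auto simp: semidirect_product_def closed mult comp one N.m_assoc H.m_assoc)
qed

text \<open>Rank \<open>0\<close> is allowed: the infinite cyclic group is free-by-cyclic.\<close>

definition free_by_cyclic :: "('a, 'b) monoid_scheme \<Rightarrow> bool" where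
  "free_by_cyclic G \<longleftrightarrow>
     (\<exists>(k::nat) \<phi>. \<phi> \<in> hom integer_group (AutoGroup (free_group {1..k})) \<and>
        G \<cong> semidirect_product (free_group {1..k}) integer_group \<phi>)"

definition relator_tuples :: "nat \<Rightarrow> nat \<Rightarrow> nat word list set" where
  "relator_tuples n l =
     {rs. length rs = n \<and>
        (\<forall>r \<in> set rs. r \<in> words_over {1..n+1} \<and> r \<noteq> [] \<and> cyclically_reduced r \<and> length r \<le> l)}"

definition deficiency_one_group :: "nat \<Rightarrow> nat word list \<Rightarrow> nat word set monoid" where
  "deficiency_one_group n rs = presented_group {1..n+1} (set rs)"

lemma finite_relator_tuples: "finite (relator_tuples n l)"
proof (rule finite_subset)
  let ?W = "{r. set r \<subseteq> {1..n+1} \<times> (UNIV :: bool set) \<and> length r \<le> l}"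
  show "relator_tuples n l \<subseteq> {rs. set rs \<subseteq> ?W \<and> length rs = n}"
    unfolding relator_tuples_def words_over_def lists_eq_set by blast
  show "finite {rs. set rs \<subseteq> ?W \<and> length rs = n}"
    by (intro finite_lists_length_eq finite_lists_length_le) simp
qed

lemma relator_tuples_nonempty:
  assumes "l \<ge> 1"
  shows "relator_tuples n l \<noteq> {}"
proof -
  have "replicate n [(1, True)] \<in> relator_tuples n l"
    using assms by (auto simp: relator_tuples_def cyclically_reduced_def reduced_Cons)
  then show ?thesis by blast
qed

lemma group_deficiency_one_group:
  assumes "rs \<in> relator_tuples n l"
  shows "group (deficiency_one_group n rs)"
proof -
  have "set rs \<subseteq> carrier (free_group {1..n+1})"
    using assms by (auto simp: relator_tuples_def free_group_def cyclically_reduced_def)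
  then show ?thesis
    unfolding deficiency_one_group_def presented_group_def
    by (intro normal.factorgroup_is_group group.normal_closure_normal group_free_group)
qed

end

(*
  If G is free-by-cyclic, then some nonzero map from G to the integers has a finitely generated
  kernel, so the Alexander module of that map is finitely generated over the integers and the
  leading coefficients of its Fox matrix are restricted. The obstruction is local: if each relator
  r_i contains, at a point of maximal height, the word s [s, x_i]^2 s^-1 with s = x_(n+1), then the
  Fox matrix without the column of s has leading part 2 I. The kernel contains s^q [s, x_1] s^-q
  for all q; finite generation would give a monic combination of their Fox derivatives in the row
  span of the matrix, all of whose top coefficients are even.

  Such presentations have positive density. Replacing a suffix of bounded length in each relator
  makes the exponent matrix congruent to (I | 0) modulo 2, which forces the map to the integers to
  be unique up to scaling and nonzero on s; inserting the words above at the first maximum is then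
  injective and lengthens each relator by 10 letters.
*)

theory Submission
  imports Defs
begin

section \<open>Heights and Fox derivatives\<close>

definition letter_height :: "('a \<Rightarrow> int) \<Rightarrow> 'a letter \<Rightarrow> int" where
  "letter_height c a = (if snd a then c (fst a) else - c (fst a))"

text \<open>The homomorphism with \<open>x\<close> sent to \<open>c x\<close>, defined on all words
  so that the heights of prefixes trace the path described by a word.\<close>

definition height :: "('a \<Rightarrow> int) \<Rightarrow> 'a word \<Rightarrow> int" where
  "height c w = sum_list (map (letter_height c) w)"

lemma height_Nil [simp]: "height c [] = 0"
  by (simp add: height_def)

lemma height_Cons [simp]: "height c (a # w) = letter_height c a + height c w"
  by (simp add: height_def)

lemma height_append [simp]: "height c (u @ v) = height c u + height c v"
  by (simp add: height_def)

lemma letter_height_inv [simp]: "letter_height c (inv_letter a) = - letter_height c a"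
  by (simp add: letter_height_def inv_letter_def)

lemma height_reduce [simp]: "height c (reduce w) = height c w"
proof -
  have "height c (cancel_cons a w) = letter_height c a + height c w" for a w
    by (cases w) auto
  then show ?thesis by (induction w) (auto simp: reduce_def)
qed

text \<open>\<open>fox c w j k\<close> is the coefficient of \<open>t\<^sup>k\<close> in the image of the Fox derivative of \<open>w\<close> with
  respect to \<open>x\<^sub>j\<close> under the ring homomorphism induced by \<open>x\<^sub>i \<mapsto> t\<^sup>c\<^sup>i\<close>. Each letter
  \<open>x\<^sub>j\<close> or \<open>x\<^sub>j\<inverse>\<close> contributes at the height of the tail of the edge it traverses.\<close>

fun fox :: "('a \<Rightarrow> int) \<Rightarrow> 'a word \<Rightarrow> 'a \<Rightarrow> int \<Rightarrow> int" where
  "fox c [] j k = 0"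
| "fox c ((x, True) # w) j k = of_bool (x = j \<and> k = 0) + fox c w j (k - c x)"
| "fox c ((x, False) # w) j k = fox c w j (k + c x) - of_bool (x = j \<and> k = - c x)"

lemma fox_Cons: "fox c (a # w) j k = fox c [a] j k + fox c w j (k - letter_height c a)"
  by (cases a; cases "snd a") (auto simp: letter_height_def)

text \<open>Fox product rule: the path of \<open>v\<close> starts at height
  \<open>height c u\<close>. On words of height 0 the derivative is therefore additive.\<close>

lemma fox_append: "fox c (u @ v) j k = fox c u j k + fox c v j (k - height c u)"
proof (induction u arbitrary: k)
  case (Cons a u)
  show ?case
    using Cons[of "k - letter_height c a"] fox_Cons[of c a u] fox_Cons[of c a "u @ v"]
    by (simp add: algebra_simps)
qed simp

text \<open>A cancelling pair runs along one edge in both directions and contributes opposite signs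
  at the same height. Hence \<open>fox\<close> depends only on the element of the free
  group.\<close>

lemma fox_reduce [simp]: "fox c (reduce w) j k = fox c w j k"
proof -
  have canc: "fox c (cancel_cons a w) j k = fox c (a # w) j k" for a w k
  proof (cases w)
    case (Cons b v)
    show ?thesis
    proof (cases "b = inv_letter a")
      case True
      then show ?thesis using Cons
        by (cases a; cases "snd a") (auto simp: inv_letter_def)
    qed (use Cons in simp)
  qed simp
  show ?thesis
  proof (induction w arbitrary: k)
    case (Cons a w)
    have "fox c (reduce (a # w)) j k = fox c (a # reduce w) j k"
      by (simp add: reduce_def canc)
    also have "\<dots> = fox c (a # w) j k"
      using Cons fox_Cons[of c a] by metis
    finally show ?case .
  qed (simp add: reduce_def)
qed

text \<open>Each letter contributes at one end of its edge: at the start if positive, at the end if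
  inverse. Both ends are reached by prefixes.\<close>

lemma fox_eq_0:
  assumes "\<And>p q. w = p @ q \<Longrightarrow> height c p \<noteq> k"
  shows "fox c w j k = 0"
  using assms
proof (induction w arbitrary: k)
  case (Cons a w)
  have "fox c w j (k - letter_height c a) = 0"
  proof (rule Cons.IH)
    fix p q assume "w = p @ q"
    then show "height c p \<noteq> k - letter_height c a"
      using Cons.prems[of "a # p" q] by simp
  qed
  moreover have "fox c [a] j k = 0"
    using Cons.prems[of "[]" "a # w"] Cons.prems[of "[a]" w]
    by (cases a; cases "snd a") (auto simp: letter_height_def)
  ultimately show ?case by (simp add: fox_Cons[of c a w])
qed simp

section \<open>Noetherianity of \<open>Z^k\<close>, elimination over the integers, leading terms
  over \<open>Z[t, t^-1]\<close>\<close>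

section \<open>Integer linear algebra\<close>

text \<open>Noetherianity of \<open>Z^k\<close>. The coefficient 1 of \<open>A q\<close> is what
  later makes a combination monic. The induction on \<open>k\<close> clears the last coordinate with
  a generator of the ideal spanned by all last coordinates.\<close>

lemma int_vectors_dependent:
  fixes A :: "nat \<Rightarrow> nat \<Rightarrow> int"
  shows "\<exists>q c. \<forall>j<k. A q j = (\<Sum>i<q. c i * A i j)"
proof (induction k arbitrary: A)
  case 0
  then show ?case by simp
next
  case (Suc k)
  define a where "a i = A i k" for i
  have "\<exists>N c z. \<forall>i. a i = z i * (\<Sum>t<N. c t * a t)"
  proof (cases "\<forall>i. a i = 0")
    case True
    then show ?thesis by auto
  next
    case False
    \<comment> \<open>The positive elements of that ideal; division with remainder shows that the
      least one divides every \<open>a i\<close>.\<close>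
    define P where "P d \<longleftrightarrow> d > 0 \<and> (\<exists>N c. int d = (\<Sum>t<N. c t * a t))" for d :: nat
    obtain i0 where i0: "a i0 \<noteq> 0" using False by blast
    have "(\<Sum>t<Suc i0. (if t = i0 then sgn (a i0) else 0) * a t) = \<bar>a i0\<bar>"
      by (simp add: mult_sgn_abs abs_sgn mult.commute)
    then have "P (nat \<bar>a i0\<bar>)"
      unfolding P_def using i0 by (metis int_nat_eq abs_ge_zero zero_less_abs_iff zero_less_nat_eq)
    then have PL: "P (LEAST d. P d)" by (rule LeastI)
    define d where "d = (LEAST d. P d)"
    obtain N c where d: "d > 0" "int d = (\<Sum>t<N. c t * a t)"
      using PL by (auto simp: P_def d_def)
    have "a i mod int d = 0" for i
    proof (rule ccontr)
      assume ne: "a i mod int d \<noteq> 0"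
      define z where "z = a i div int d"
      define c' where "c' t = of_bool (t = i) - z * (if t < N then c t else 0)" for t
      have "(\<Sum>t<max N (Suc i). (if t < N then c t else 0) * a t) = (\<Sum>t<N. c t * a t)"
        by (rule sum.mono_neutral_cong_right) auto
      moreover have "(\<Sum>t<max N (Suc i). of_bool (t = i) * a t) = a i"
        by (subst sum.mono_neutral_cong_right[of _ "{i}" _ a]) auto
      ultimately have "(\<Sum>t<max N (Suc i). c' t * a t) = a i - z * int d"
        by (simp add: c'_def left_diff_distrib sum_subtractf d(2) mult.assoc flip: sum_distrib_left)
      also have "\<dots> = a i mod int d"
        by (simp add: z_def minus_div_mult_eq_mod)
      finally have "P (nat (a i mod int d))"
        unfolding P_def using ne d(1) pos_mod_sign[of "int d" "a i"] less_le[of 0 "a i mod int d"]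
        by (auto intro!: exI[of _ "max N (Suc i)"] exI[of _ c'])
      then have "d \<le> nat (a i mod int d)" unfolding d_def by (rule Least_le)
      then show False using pos_mod_bound[of "int d" "a i"] d(1) by linarith
    qed
    then have "a i = (a i div int d) * (\<Sum>t<N. c t * a t)" for i
      using d(2) by (metis dvd_div_mult_self mod_0_imp_dvd)
    then show ?thesis by (intro exI allI)
  qed
  then obtain N c z where az: "\<And>i. a i = z i * (\<Sum>t<N. c t * a t)" by blast
  \<comment> \<open>Subtracting multiples of the generating combination clears coordinate
    \<open>k\<close>. Starting at \<open>N\<close> keeps the rows used by it earlier than the row to
    be expressed.\<close>
  define A' where "A' i j = A (N + i) j - z (N + i) * (\<Sum>t<N. c t * A t j)" for i j
  obtain q c' where q: "\<forall>j<k. A' q j = (\<Sum>i<q. c' i * A' i j)" using Suc.IH by blast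
  have "A' i k = 0" for i using az[of "N + i"] by (simp add: A'_def a_def)
  then have q': "A' q j = (\<Sum>i<q. c' i * A' i j)" if "j < Suc k" for j
    using q that by (cases "j = k") auto
  \<comment> \<open>Undoing the subtraction collects all multiples of the generating combination on
    the first \<open>N\<close> rows.\<close>
  define c'' where
    "c'' i = (if i < N then (z (N + q) - (\<Sum>i'<q. c' i' * z (N + i'))) * c i else c' (i - N))" for i
  have "A (N + q) j = (\<Sum>i<N + q. c'' i * A i j)" if "j < Suc k" for j
  proof -
    define S where "S = (\<Sum>t<N. c t * A t j)"
    have "(\<Sum>i<N + q. c'' i * A i j) = (\<Sum>i<N. c'' i * A i j) + (\<Sum>i=N..<N + q. c'' i * A i j)"
      by (metis add.commute le_add2 sum.atLeastLessThan_concat atLeast0LessThan le_add1 zero_le)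
    also have "(\<Sum>i=N..<N + q. c'' i * A i j) = (\<Sum>i<q. c' i * A (N + i) j)"
      by (rule sum.reindex_bij_witness[of _ "\<lambda>i. N + i" "\<lambda>i. i - N"]) (auto simp: c''_def)
    also have "(\<Sum>i<N. c'' i * A i j) = (z (N + q) - (\<Sum>i'<q. c' i' * z (N + i'))) * S"
      by (simp add: c''_def S_def sum_distrib_left mult.assoc)
    finally have 1: "(\<Sum>i<N + q. c'' i * A i j) =
        (z (N + q) - (\<Sum>i'<q. c' i' * z (N + i'))) * S + (\<Sum>i<q. c' i * A (N + i) j)" .
    have "A (N + q) j - z (N + q) * S = (\<Sum>i<q. c' i * A (N + i) j) - (\<Sum>i<q. c' i * z (N + i)) * S"
      using q'[OF that] unfolding A'_def S_def[symmetric]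
      by (simp add: right_diff_distrib sum_subtractf sum_distrib_right mult.assoc)
    with 1 show ?thesis by (simp add: algebra_simps)
  qed
  then show ?case by blast
qed

text \<open>Gaussian elimination by cross-multiplication, which stays integral: a pivot in equation
  \<open>m\<close> removes one unknown and one equation.\<close>

lemma homogeneous_system_solution:
  fixes E :: "nat \<Rightarrow> 'a \<Rightarrow> int"
  assumes "finite J" "m < card J"
  shows "\<exists>c. (\<exists>j\<in>J. c j \<noteq> 0) \<and> (\<forall>i<m. (\<Sum>j\<in>J. c j * E i j) = 0)"
  using assms
proof (induction m arbitrary: J E)
  case 0
  then have "J \<noteq> {}" by auto
  then show ?case by (intro exI[of _ "\<lambda>_. 1"]) auto
next
  case (Suc m)
  show ?case
  proof (cases "\<forall>j\<in>J. E m j = 0")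
    case True
    obtain c where "\<exists>j\<in>J. c j \<noteq> 0" "\<forall>i<m. (\<Sum>j\<in>J. c j * E i j) = 0"
      using Suc.IH[of J E] Suc.prems by auto
    then show ?thesis using True by (intro exI[of _ c]) (auto simp: less_Suc_eq)
  next
    case False
    then obtain j0 where j0: "j0 \<in> J" "E m j0 \<noteq> 0" by blast
    define E' where "E' i j = E m j0 * E i j - E i j0 * E m j" for i j
    have "m < card (J - {j0})" using Suc.prems j0 by simp
    then obtain c where c: "\<exists>j\<in>J - {j0}. c j \<noteq> 0" "\<And>i. i < m \<Longrightarrow> (\<Sum>j\<in>J - {j0}. c j * E' i j) = 0"
      using Suc.IH[of "J - {j0}" E'] Suc.prems by auto
    \<comment> \<open>The pivot unknown solves equation \<open>m\<close>; the other unknowns are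
      multiplied by the nonzero pivot entry, which avoids a division.\<close>
    define c' where "c' j = (if j = j0 then - (\<Sum>j\<in>J - {j0}. c j * E m j) else E m j0 * c j)" for j
    have sum: "(\<Sum>j\<in>J. c' j * E i j) = (\<Sum>j\<in>J - {j0}. c j * E' i j)" for i
    proof -
      have "(\<Sum>j\<in>J. c' j * E i j) = c' j0 * E i j0 + (\<Sum>j\<in>J - {j0}. c' j * E i j)"
        using Suc.prems j0 by (simp add: sum.remove)
      also have "(\<Sum>j\<in>J - {j0}. c' j * E i j) = (\<Sum>j\<in>J - {j0}. E m j0 * c j * E i j)"
        by (rule sum.cong) (auto simp: c'_def)
      also have "c' j0 * E i j0 = - (\<Sum>j\<in>J - {j0}. c j * E m j * E i j0)"
        by (simp add: c'_def sum_distrib_right)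
      also have "\<dots> + (\<Sum>j\<in>J - {j0}. E m j0 * c j * E i j) = (\<Sum>j\<in>J - {j0}. c j * E' i j)"
        unfolding sum_negf[symmetric] sum.distrib[symmetric]
        by (rule sum.cong) (auto simp: E'_def algebra_simps)
      finally show ?thesis .
    qed
    have "(\<Sum>j\<in>J. c' j * E i j) = 0" if "i < Suc m" for i
    proof (cases "i = m")
      case True
      then show ?thesis unfolding sum by (auto simp: E'_def)
    next
      case False
      then show ?thesis using that c(2) sum by auto
    qed
    moreover have "\<exists>j\<in>J. c' j \<noteq> 0" using c(1) j0 by (auto simp: c'_def)
    ultimately show ?thesis by blast
  qed
qed

text \<open>Membership in the \<open>Z[t, t^-1]\<close>-span of the rows \<open>D i\<close>:
  \<open>b i e\<close> is the coefficient of \<open>t^e\<close> in the multiplier of row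
  \<open>i\<close>, and \<open>E\<close> is a common finite support, so that supports can be merged
  in sums.\<close>

definition shift_combination :: "nat \<Rightarrow> (nat \<Rightarrow> 'a \<Rightarrow> int \<Rightarrow> int) \<Rightarrow> ('a \<Rightarrow> int \<Rightarrow> int) \<Rightarrow> bool" where
  "shift_combination n D f \<longleftrightarrow>
     (\<exists>b E. finite E \<and> (\<forall>i e. e \<notin> E \<longrightarrow> b i e = 0) \<and>
        (\<forall>j k. f j k = (\<Sum>i<n. \<Sum>e\<in>E. b i e * D i j (k - e))))"

lemma shift_combination_zero: "shift_combination n D (\<lambda>j k. 0)"
  unfolding shift_combination_def by (intro exI[of _ "\<lambda>_ _. 0"] exI[of _ "{}"]) auto

lemma shift_combination_shift:
  assumes "i < n"
  shows "shift_combination n D (\<lambda>j k. D i j (k - e))"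
proof -
  have "(\<Sum>i'<n. \<Sum>e'\<in>{e}. of_bool (i' = i \<and> e' = e) * D i' j (k - e')) = D i j (k - e)" for j k
    using assms
    by (subst sum.mono_neutral_cong_right[of _ "{i}" _ "\<lambda>i. D i j (k - e)"]) auto
  then show ?thesis
    unfolding shift_combination_def
    by (intro exI[of _ "\<lambda>i' e'. of_bool (i' = i \<and> e' = e)"] exI[of _ "{e}"]) simp
qed

lemma shift_combination_lincomb:
  assumes "shift_combination n D f" "shift_combination n D g"
  shows "shift_combination n D (\<lambda>j k. f j k + m * g j k)"
proof -
  obtain b E where b: "finite E" "\<And>i e. e \<notin> E \<Longrightarrow> b i e = 0"
      "\<And>j k. f j k = (\<Sum>i<n. \<Sum>e\<in>E. b i e * D i j (k - e))"
    using assms(1) unfolding shift_combination_def by blast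
  obtain b' E' where b': "finite E'" "\<And>i e. e \<notin> E' \<Longrightarrow> b' i e = 0"
      "\<And>j k. g j k = (\<Sum>i<n. \<Sum>e\<in>E'. b' i e * D i j (k - e))"
    using assms(2) unfolding shift_combination_def by blast
  have "f j k + m * g j k = (\<Sum>i<n. \<Sum>e\<in>E \<union> E'. (b i e + m * b' i e) * D i j (k - e))" for j k
  proof -
    have "(\<Sum>e\<in>E. b i e * D i j (k - e)) = (\<Sum>e\<in>E \<union> E'. b i e * D i j (k - e))" for i
      using b b' by (intro sum.mono_neutral_left) auto
    moreover have "(\<Sum>e\<in>E'. b' i e * D i j (k - e)) = (\<Sum>e\<in>E \<union> E'. b' i e * D i j (k - e))" for i
      using b b' by (intro sum.mono_neutral_left) auto
    ultimately show ?thesis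
      by (simp add: b(3) b'(3) distrib_right sum.distrib sum_distrib_left mult.assoc)
  qed
  then show ?thesis
    unfolding shift_combination_def using b b'
    by (intro exI[of _ "\<lambda>i e. b i e + m * b' i e"] exI[of _ "E \<union> E'"]) auto
qed

text \<open>Row \<open>i\<close> of \<open>D\<close> has leading term \<open>2 t\<^bsup>h i\<^esup> e\<^sub>i\<close>, so the top-degree terms of a
  combination cannot cancel and are even.\<close>

lemma shift_combination_top_even:
  assumes f: "shift_combination n D f"
    and vanish: "\<And>i j k. i < n \<Longrightarrow> j < n \<Longrightarrow> k > h i \<Longrightarrow> D i (g j) k = 0"
    and lead: "\<And>i j. i < n \<Longrightarrow> j < n \<Longrightarrow> D i (g j) (h i) = (if i = j then 2 else 0)"
    and top: "\<And>j k. j < n \<Longrightarrow> k > d \<Longrightarrow> f (g j) k = 0"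
    and "j < n"
  shows "even (f (g j) d)"
proof -
  obtain b E where E: "finite E" "\<And>i e. e \<notin> E \<Longrightarrow> b i e = 0"
      and fb: "\<And>j k. f j k = (\<Sum>i<n. \<Sum>e\<in>E. b i e * D i j (k - e))"
    using f unfolding shift_combination_def by blast
  \<comment> \<open>The degrees of the leading terms of the nonzero summands.\<close>
  define T where "T = {e + h i | e i. i < n \<and> e \<in> E \<and> b i e \<noteq> 0}"
  have "T \<subseteq> (\<lambda>(e, i). e + h i) ` (E \<times> {..<n})" unfolding T_def by auto
  then have finT: "finite T" using E(1) by (auto intro: finite_subset)
  \<comment> \<open>In a degree not below any element of \<open>T\<close> only leading terms
    contribute, and different rows lead in different columns.\<close>
  have high: "f (g j) k = (if k \<in> T then 2 * b j (k - h j) else 0)"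
    if k: "\<And>t. t \<in> T \<Longrightarrow> t \<le> k" and j: "j < n" for j k
  proof -
    have summand: "b i e * D i (g j) (k - e) = (if i = j \<and> e = k - h j then 2 * b i e else 0)"
      if "i < n" "e \<in> E" for i e
    proof (cases "b i e = 0")
      case False
      then have "e + h i \<le> k" using that k by (auto simp: T_def)
      then consider "k - e > h i" | "k - e = h i" by linarith
      then show ?thesis
        using vanish[OF that(1) j] lead[OF that(1) j] by cases auto
    qed auto
    have "f (g j) k = (\<Sum>i<n. \<Sum>e\<in>E. if i = j \<and> e = k - h j then 2 * b i e else 0)"
      unfolding fb by (intro sum.cong refl summand) auto
    also have "\<dots> = (\<Sum>i<n. if i = j then \<Sum>e\<in>E. if e = k - h j then 2 * b i e else 0 else 0)"
      by (intro sum.cong) auto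
    also have "\<dots> = (if k - h j \<in> E then 2 * b j (k - h j) else 0)"
      using j E(1) by (simp add: sum.delta)
    also have "\<dots> = 2 * b j (k - h j)" using E(2) by auto
    also have "\<dots> = (if k \<in> T then 2 * b j (k - h j) else 0)"
    proof (cases "b j (k - h j) = 0")
      case False
      then have "k - h j \<in> E" using E(2) by blast
      then have "k \<in> T" unfolding T_def using False j by (intro CollectI exI[of _ "k - h j"] exI[of _ j]) auto
      then show ?thesis by simp
    qed simp
    finally show ?thesis .
  qed
  \<comment> \<open>Otherwise the coefficient in degree \<open>Max T > d\<close> would be nonzero in
    some column, against \<open>top\<close>.\<close>
  have "t \<le> d" if "t \<in> T" for t
  proof (rule ccontr)
    assume "\<not> t \<le> d"
    define m where "m = Max T"
    have m: "m \<in> T" "\<And>t. t \<in> T \<Longrightarrow> t \<le> m" "t \<le> m"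
      unfolding m_def using finT that by (auto intro: Max_in Max_ge)
    obtain e i where ei: "m = e + h i" "i < n" "b i e \<noteq> 0" using m(1) by (auto simp: T_def)
    then have "f (g i) m \<noteq> 0" using high[OF m(2) ei(2)] m(1) by auto
    moreover have "f (g i) m = 0" using top ei(2) m(3) \<open>\<not> t \<le> d\<close> by auto
    ultimately show False by simp
  qed
  then show ?thesis using high[of d j] \<open>j < n\<close> by simp
qed

section \<open>An obstruction to being free-by-cyclic\<close>

lemma carrier_free_group: "carrier (free_group X) = {w \<in> words_over X. reduced w}"
  and mult_free_group [simp]: "u \<otimes>\<^bsub>free_group X\<^esub> v = reduce (u @ v)"
  and one_free_group [simp]: "\<one>\<^bsub>free_group X\<^esub> = []"
  by (simp_all add: free_group_def)

lemma singleton_in_free_group: "fst a \<in> X \<Longrightarrow> [a] \<in> carrier (free_group X)"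
  by (simp add: carrier_free_group reduced_Cons)

text \<open>The projection to the integer factor pulls back to a height function \<open>c\<close>.
  Its kernel is generated by the normal closure of the relators and by lifts \<open>g i\<close> of
  the finitely many free generators of the fibre.\<close>

lemma free_by_cyclic_presentation:
  assumes fbc: "free_by_cyclic (presented_group X R)" and R: "R \<subseteq> carrier (free_group X)"
  obtains c :: "'a \<Rightarrow> int" and K g where
    "\<And>r. r \<in> R \<Longrightarrow> height c r = 0" "\<exists>x\<in>X. c x \<noteq> 0" "finite (K :: nat set)"
    "\<And>i. i \<in> K \<Longrightarrow> g i \<in> carrier (free_group X) \<and> height c (g i) = 0"
    "\<And>w. w \<in> carrier (free_group X) \<Longrightarrow> height c w = 0 \<Longrightarrow>
       w \<in> generate (free_group X) (normal_closure (free_group X) R \<union> g ` K)"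
proof -
  define F where "F = free_group X"
  define N where "N = normal_closure F R"
  interpret F: group F unfolding F_def by (rule group_free_group)
  have N: "N \<lhd> F" unfolding N_def F_def
    using R by (intro group.normal_closure_normal group_free_group)
  interpret N: normal N F by (rule N)
  obtain k \<phi> where \<phi>: "\<phi> \<in> hom integer_group (AutoGroup (free_group {1..k::nat}))"
      and "presented_group X R \<cong> semidirect_product (free_group {1..k}) integer_group \<phi>"
    using fbc unfolding free_by_cyclic_def by blast
  define L where "L = free_group {1..k}"
  define S where "S = semidirect_product L integer_group \<phi>"
  interpret L: group L unfolding L_def by (rule group_free_group)
  interpret S: group S unfolding S_def L_def
    by (intro group_semidirect_product group_free_group group_integer_group \<phi>)
  obtain \<theta> where \<theta>: "\<theta> \<in> iso (F Mod N) S"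
    using \<open>presented_group X R \<cong> _\<close>
    by (auto simp: is_iso_def presented_group_def F_def N_def S_def L_def)
  \<comment> \<open>The quotient map followed by the isomorphism: a surjection from the free group
    to \<open>S\<close> with kernel \<open>N\<close>.\<close>
  define \<Theta> where "\<Theta> w = \<theta> (N #>\<^bsub>F\<^esub> w)" for w
  have hom: "\<Theta> \<in> hom F S"
    using hom_compose[OF N.r_coset_hom_Mod, of \<theta> S] \<theta>
    by (simp add: iso_def \<Theta>_def[abs_def] comp_def)
  interpret \<Theta>: group_hom F S \<Theta> by unfold_locales (rule hom)
  have surj: "\<exists>w\<in>carrier F. \<Theta> w = y" if "y \<in> carrier S" for y
  proof -
    have "y \<in> \<theta> ` carrier (F Mod N)" using \<theta> that by (simp add: iso_iff)
    then show ?thesis by (auto simp: \<Theta>_def FactGroup_def RCOSETS_def)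
  qed
  have ker: "w \<in> N" if w: "w \<in> carrier F" "\<Theta> w = \<one>\<^bsub>S\<^esub>" for w
  proof -
    have "\<Theta> w = \<Theta> \<one>\<^bsub>F\<^esub>" using w by simp
    moreover have "inj_on \<theta> (carrier (F Mod N))" using \<theta> by (simp add: iso_iff)
    ultimately have "N #>\<^bsub>F\<^esub> w = N #>\<^bsub>F\<^esub> \<one>\<^bsub>F\<^esub>"
      using w(1) unfolding \<Theta>_def inj_on_def by (auto simp: FactGroup_def RCOSETS_def)
    also have "\<dots> = N" using N.subset by (rule F.coset_mult_one)
    finally show ?thesis using F.rcos_self[OF w(1)] N.subgroup_axioms by blast
  qed
  have Nker: "\<Theta> w = \<one>\<^bsub>S\<^esub>" if "w \<in> N" for w
  proof -
    have "N #>\<^bsub>F\<^esub> w = N" using that by (rule N.rcos_const[OF F.is_group])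
    also have "\<dots> = N #>\<^bsub>F\<^esub> \<one>\<^bsub>F\<^esub>" using N.subset by (rule F.coset_mult_one[symmetric])
    finally show ?thesis using \<Theta>.hom_one by (simp add: \<Theta>_def)
  qed
  have carS: "carrier S = carrier L \<times> UNIV" and oneS: "\<one>\<^bsub>S\<^esub> = ([], 0)"
    and multS: "(a, h) \<otimes>\<^bsub>S\<^esub> (b, h') = (reduce (a @ \<phi> h b), h + h')" for a h b h'
    by (simp_all add: S_def L_def semidirect_product_def)
  have \<phi>0: "\<phi> 0 a = a" if "a \<in> carrier L" for a
  proof -
    have "\<phi> \<one>\<^bsub>integer_group\<^esub> = \<one>\<^bsub>AutoGroup L\<^esub>"
      using hom_one[OF \<phi>[folded L_def] group_integer_group L.AutoGroup] .
    then show ?thesis using that by (simp add: AutoGroup_def BijGroup_def)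
  qed
  \<comment> \<open>The integer coordinate is additive, so it is determined by its values
    \<open>c\<close> on the generators.\<close>
  define \<psi> where "\<psi> w = snd (\<Theta> w)" for w
  have \<psi>_mult: "\<psi> (u \<otimes>\<^bsub>F\<^esub> v) = \<psi> u + \<psi> v" if "u \<in> carrier F" "v \<in> carrier F" for u v
    using \<Theta>.hom_mult[OF that] multS by (metis \<psi>_def prod.collapse snd_conv)
  have \<psi>_one: "\<psi> [] = 0"
    using \<Theta>.hom_one by (simp add: \<psi>_def oneS F_def)
  define c where "c x = \<psi> [(x, True)]" for x
  have letter: "\<psi> [a] = letter_height c a" if "fst a \<in> X" for a
  proof (cases a)
    case (Pair x b)
    have "\<psi> ([(x, True)] \<otimes>\<^bsub>F\<^esub> [(x, False)]) = \<psi> [(x, True)] + \<psi> [(x, False)]"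
      using that Pair by (intro \<psi>_mult) (auto simp: F_def singleton_in_free_group)
    then have "\<psi> [(x, False)] = - \<psi> [(x, True)]"
      using \<psi>_one by (simp add: F_def reduce_def inv_letter_def)
    then show ?thesis using Pair by (cases b) (auto simp: letter_height_def c_def)
  qed
  have \<psi>_height: "\<psi> w = height c w" if "w \<in> carrier F" for w
    using that
  proof (induction w)
    case (Cons a w)
    have aw: "w \<in> carrier F" "fst a \<in> X"
      using Cons.prems by (auto simp: F_def carrier_free_group reduced_Cons)
    have "\<psi> ([a] \<otimes>\<^bsub>F\<^esub> w) = \<psi> [a] + \<psi> w"
      using aw by (intro \<psi>_mult) (auto simp: F_def singleton_in_free_group)
    then show ?case
      using Cons aw letter by (simp add: F_def carrier_free_group reduce_reduced)
  qed (simp add: \<psi>_one)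
  define g where "g i = (SOME w. w \<in> carrier F \<and> \<Theta> w = ([(i, True)], 0))" for i
  have g: "g i \<in> carrier F \<and> \<Theta> (g i) = ([(i, True)], 0)" if "i \<in> {1..k}" for i
  proof -
    have "([(i, True)], 0) \<in> carrier S"
      using that by (simp add: carS L_def singleton_in_free_group)
    from surj[OF this] have "\<exists>w. w \<in> carrier F \<and> \<Theta> w = ([(i, True)], 0)" by blast
    then show ?thesis unfolding g_def by (rule someI_ex)
  qed
  define H where "H = generate F (N \<union> g ` {1..k})"
  have H: "subgroup H F" unfolding H_def
    using g N.subset by (intro F.generate_is_subgroup) auto
  \<comment> \<open>Induction on the fibre word \<open>y\<close>: multiplying by the inverse of a
    lift strips its first letter, and for empty \<open>y\<close> the word lies in
    \<open>N\<close>.\<close>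
  have gen: "w \<in> H" if "w \<in> carrier F" "y \<in> carrier L" "\<Theta> w = (y, 0)" for w y
    using that
  proof (induction y arbitrary: w)
    case Nil
    then show ?case using ker oneS unfolding H_def by (auto intro: generate.incl)
  next
    case (Cons a y)
    obtain i b where a: "a = (i, b)" by (cases a)
    have y: "y \<in> carrier L" "i \<in> {1..k}" "reduced (a # y)"
      using Cons.prems a by (auto simp: L_def carrier_free_group reduced_Cons)
    have letters: "([(i, b')], 0) \<in> carrier S" for b'
      using y by (simp add: carS L_def singleton_in_free_group)
    define g' where "g' = (if b then g i else inv\<^bsub>F\<^esub> (g i))"
    have "g i \<in> H" using y unfolding H_def by (auto intro: generate.incl)
    then have g'H: "g' \<in> H" unfolding g'_def using subgroup.m_inv_closed[OF H] by auto
    have "inv\<^bsub>S\<^esub> ([(i, True)], 0) = ([(i, False)], 0)"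
    proof (rule S.inv_equality)
      have "\<phi> 0 [(i, True)] = [(i, True)]"
        using y by (intro \<phi>0) (auto simp: L_def singleton_in_free_group)
      then show "([(i, False)], 0) \<otimes>\<^bsub>S\<^esub> ([(i, True)], 0) = \<one>\<^bsub>S\<^esub>"
        by (simp add: multS oneS reduce_def inv_letter_def)
    qed (use letters in auto)
    then have \<Theta>g': "\<Theta> g' = ([a], 0)" using g[OF y(2)] a by (auto simp: g'_def)
    have g'F: "g' \<in> carrier F" using g'H subgroup.subset[OF H] by blast
    have yS: "(y, 0) \<in> carrier S" using y by (simp add: carS)
    have "\<Theta> w = \<Theta> g' \<otimes>\<^bsub>S\<^esub> (y, 0)"
      using Cons.prems y by (simp add: \<Theta>g' multS \<phi>0 reduce_reduced)
    then have "\<Theta> (inv\<^bsub>F\<^esub> g' \<otimes>\<^bsub>F\<^esub> w) = (y, 0)"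
      using g'F Cons.prems(1) yS by (simp add: S.m_assoc[symmetric])
    then have "inv\<^bsub>F\<^esub> g' \<otimes>\<^bsub>F\<^esub> w \<in> H"
      using y g'F Cons.prems(1) by (intro Cons.IH) auto
    then have "g' \<otimes>\<^bsub>F\<^esub> (inv\<^bsub>F\<^esub> g' \<otimes>\<^bsub>F\<^esub> w) \<in> H"
      using subgroup.m_closed[OF H] g'H by blast
    then show ?case using g'F Cons.prems(1) by (simp add: F.m_assoc[symmetric])
  qed
  show thesis
  proof (rule that[of c "{1..k}" g])
    fix r assume "r \<in> R"
    then have "r \<in> N" using group.normal_closure_superset[OF group_free_group R] by (auto simp: N_def F_def)
    then have "\<psi> r = 0" using Nker by (simp add: \<psi>_def oneS)
    then show "height c r = 0" using \<open>r \<in> R\<close> R \<psi>_height by (auto simp: F_def)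
  next
    \<comment> \<open>The projection takes the value 1, so \<open>c\<close> cannot vanish on all
      generators.\<close>
    have "([], 1) \<in> carrier S" by (simp add: carS L_def carrier_free_group)
    from surj[OF this] obtain w where w: "w \<in> carrier F" "\<Theta> w = ([], 1)" by blast
    have "height c w = 1" using \<psi>_height[OF w(1)] w(2) by (simp add: \<psi>_def)
    moreover have "height c w = 0" if "\<forall>x\<in>X. c x = 0"
    proof -
      have "\<forall>a\<in>set w. fst a \<in> X" using w by (simp add: F_def carrier_free_group in_words_over_iff)
      then show ?thesis using that by (induction w) (auto simp: letter_height_def)
    qed
    ultimately show "\<exists>x\<in>X. c x \<noteq> 0" by fastforce
  next
    fix i assume "i \<in> {1..k}"
    then show "g i \<in> carrier (free_group X) \<and> height c (g i) = 0"
      using g \<psi>_height[of "g i"] by (auto simp: F_def \<psi>_def)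
  next
    fix w assume w: "w \<in> carrier (free_group X)" "height c w = 0"
    obtain y h where yh: "\<Theta> w = (y, h)" by (cases "\<Theta> w")
    then have "h = 0" using \<psi>_height[of w] w by (simp add: F_def \<psi>_def)
    moreover have "y \<in> carrier L"
      using yh \<Theta>.hom_closed[of w] w by (simp add: carS F_def)
    ultimately show "w \<in> generate (free_group X) (normal_closure (free_group X) R \<union> g ` {1..k})"
      using gen[of w y] w yh by (simp add: F_def H_def N_def)
  qed simp
qed

section \<open>The inserted word and the obstruction to a finitely generated kernel\<close>

definition insertion :: "'a \<Rightarrow> 'a \<Rightarrow> 'a word" where
  "insertion s x =
     [(s, True), (s, True), (x, True), (s, False), (x, False),
      (s, True), (x, True), (s, False), (x, False), (s, False)]"

lemma height_insertion [simp]: "height c (insertion s x) = 0"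
  by (simp add: insertion_def letter_height_def)

text \<open>The derivative of \<open>[s, x]\<close> with respect to \<open>x\<close> is
  \<open>t^(c s) - 1\<close>. As \<open>[s, x]\<close> has height 0, squaring doubles it, and
  conjugating by \<open>s\<close> shifts it by \<open>c s\<close>.\<close>

lemma fox_insertion:
  assumes "j \<noteq> s" "c s > 0"
  shows "fox c (insertion s x) j k =
    (if j = x then 2 * of_bool (k = 2 * c s) - 2 * of_bool (k = c s) else 0)"
  using assms by (auto simp: insertion_def)

text \<open>Fox vectors are additive on the kernel and send the normal closure into the row span of
  the Fox matrix. Finite generation would make them a finitely generated abelian group modulo that
  span; parity of top coefficients excludes this. The conditions on \<open>u\<close> and
  \<open>v\<close> place each inserted word at maximal height.\<close>

lemma kernel_not_finitely_generated:
  fixes s :: 'a and x :: "nat \<Rightarrow> 'a" and rs :: "'a word list"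
  assumes c: "\<And>r. r \<in> set rs \<Longrightarrow> height c r = 0" and s: "c s > 0" "s \<in> X"
    and rsF: "set rs \<subseteq> carrier (free_group X)"
    and x: "inj_on x {..<length rs}" "x ` {..<length rs} \<subseteq> X - {s}" and ne: "rs \<noteq> []"
    and r: "\<And>i. i < length rs \<Longrightarrow> rs ! i = u i @ insertion s (x i) @ v i"
    and u: "\<And>i p q. i < length rs \<Longrightarrow> u i = p @ q \<Longrightarrow> height c p \<le> height c (u i)"
    and v: "\<And>i p q. i < length rs \<Longrightarrow> v i = p @ q \<Longrightarrow> height c p \<le> 0"
    and K: "finite (K :: nat set)"
    and g: "\<And>i. i \<in> K \<Longrightarrow> g i \<in> carrier (free_group X) \<and> height c (g i) = 0"
    and gen: "\<And>w. w \<in> carrier (free_group X) \<Longrightarrow> height c w = 0 \<Longrightarrow>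
       w \<in> generate (free_group X) (normal_closure (free_group X) (set rs) \<union> g ` K)"
  shows False
proof -
  define F where "F = free_group X"
  interpret F: group F unfolding F_def by (rule group_free_group)
  define n where "n = length rs"
  define D where "D i = fox c (rs ! i)" for i
  have n: "n > 0" using ne by (simp add: n_def)
  have fox_inv: "fox c (inv\<^bsub>F\<^esub> w) j k = - fox c w j (k + height c w)"
    and height_inv: "height c (inv\<^bsub>F\<^esub> w) = - height c w" if "w \<in> carrier F" for w j k
  proof -
    have *: "reduce (w @ inv\<^bsub>F\<^esub> w) = []"
      using F.r_inv[OF that] by (simp add: F_def)
    have "height c (reduce (w @ inv\<^bsub>F\<^esub> w)) = 0" unfolding * by simp
    then show "height c (inv\<^bsub>F\<^esub> w) = - height c w" by simp
    have "fox c (reduce (w @ inv\<^bsub>F\<^esub> w)) j (k + height c w) = 0" unfolding * by simp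
    then show "fox c (inv\<^bsub>F\<^esub> w) j k = - fox c w j (k + height c w)"
      by (simp add: fox_append)
  qed
  \<comment> \<open>Modulo the row span, the Fox vector of \<open>w\<close> is an integer
    combination of those of the \<open>g i\<close>. The predicate \<open>P\<close> below asks for
    the row span itself.\<close>
  define Q where "Q w \<longleftrightarrow> w \<in> carrier F \<and> height c w = 0 \<and>
    (\<exists>a. shift_combination n D (\<lambda>j k. fox c w j k + (\<Sum>i\<in>K. a i * fox c (g i) j k)))" for w
  define P where "P w \<longleftrightarrow> w \<in> carrier F \<and> height c w = 0 \<and> shift_combination n D (fox c w)" for w
  have lin: "shift_combination n D h"
    if "shift_combination n D f" "shift_combination n D f'" "\<And>j k. h j k = f j k + m * f' j k"
    for f f' h m
    using shift_combination_lincomb[OF that(1,2), of m] that(3) by presburger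
  have zero: "shift_combination n D f" if "\<And>j k. f j k = 0" for f
    using shift_combination_zero[of n D] that by presburger
  have subP: "subgroup {w. P w} F"
  proof (rule F.subgroupI)
    show "{w. P w} \<subseteq> carrier F" by (auto simp: P_def)
    have "P []" by (auto simp: P_def F_def carrier_free_group intro!: zero)
    then show "{w. P w} \<noteq> {}" by blast
  next
    fix w assume "w \<in> {w. P w}"
    then have w: "P w" by simp
    show "inv\<^bsub>F\<^esub> w \<in> {w. P w}"
      using w lin[OF zero[of "\<lambda>_ _. 0"], of "fox c w" "fox c (inv\<^bsub>F\<^esub> w)" "-1"]
      by (auto simp: P_def fox_inv height_inv)
  next
    fix w w' assume "w \<in> {w. P w}" "w' \<in> {w. P w}"
    then have w: "P w" "P w'" by auto
    then have "w \<otimes>\<^bsub>F\<^esub> w' \<in> carrier F" by (auto simp: P_def)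
    then show "w \<otimes>\<^bsub>F\<^esub> w' \<in> {w. P w}"
      using w lin[of "fox c w" "fox c w'" "fox c (w \<otimes>\<^bsub>F\<^esub> w')" 1]
      by (auto simp: P_def F_def fox_append)
  qed
  have "normal_closure F (set rs) \<subseteq> {w. P w}"
    unfolding normal_closure_def
  proof (rule F.generate_subgroup_incl[OF _ subP], safe)
    fix h r assume h: "h \<in> carrier F" and rr: "r \<in> set rs"
    obtain i where i: "i < n" "r = rs ! i" using rr by (metis in_set_conv_nth n_def)
    have rF: "r \<in> carrier F" using rsF rr by (auto simp: F_def)
    have r0: "height c r = 0" using c rr by simp
    \<comment> \<open>Since \<open>r\<close> has height 0, the contributions of \<open>h\<close> and
      its inverse cancel and leave row \<open>i\<close> shifted by the height of
      \<open>h\<close>.\<close>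
    have "fox c (h \<otimes>\<^bsub>F\<^esub> r \<otimes>\<^bsub>F\<^esub> inv\<^bsub>F\<^esub> h) j k = D i j (k - height c h)" for j k
      using fox_inv[OF h] r0 by (simp add: F_def fox_append D_def i(2))
    moreover have "height c (h \<otimes>\<^bsub>F\<^esub> r \<otimes>\<^bsub>F\<^esub> inv\<^bsub>F\<^esub> h) = 0"
      using height_inv[OF h] r0 by (simp add: F_def)
    moreover have "h \<otimes>\<^bsub>F\<^esub> r \<otimes>\<^bsub>F\<^esub> inv\<^bsub>F\<^esub> h \<in> carrier F" using h rF by simp
    ultimately show "P (h \<otimes>\<^bsub>F\<^esub> r \<otimes>\<^bsub>F\<^esub> inv\<^bsub>F\<^esub> h)"
      unfolding P_def using shift_combination_shift[OF i(1), of D "height c h"] by presburger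
  qed
  moreover have PQ: "Q w" if "P w" for w
    using that unfolding P_def Q_def by (auto intro!: exI[of _ "\<lambda>_. 0"])
  moreover have gQ: "Q (g i0)" if i0: "i0 \<in> K" for i0
  proof -
    have "(\<Sum>i\<in>K. - of_bool (i = i0) * fox c (g i) j k) = - fox c (g i0) j k" for j k
      using K i0 by (subst sum.mono_neutral_cong_right[of _ "{i0}" _ "\<lambda>i. - fox c (g i) j k"]) auto
    then show ?thesis unfolding Q_def using g[OF i0]
      by (auto simp: F_def intro!: exI[of _ "\<lambda>i. - of_bool (i = i0)"] zero)
  qed
  moreover have subQ: "subgroup {w. Q w} F"
  proof (rule F.subgroupI)
    show "{w. Q w} \<subseteq> carrier F" by (auto simp: Q_def)
    have "P []" by (auto simp: P_def F_def carrier_free_group intro!: zero)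
    then show "{w. Q w} \<noteq> {}" using PQ by blast
  next
    fix w assume "w \<in> {w. Q w}"
    then obtain a where w: "w \<in> carrier F" "height c w = 0"
      "shift_combination n D (\<lambda>j k. fox c w j k + (\<Sum>i\<in>K. a i * fox c (g i) j k))"
      by (auto simp: Q_def)
    have "shift_combination n D (\<lambda>j k. fox c (inv\<^bsub>F\<^esub> w) j k + (\<Sum>i\<in>K. (- a i) * fox c (g i) j k))"
      by (rule lin[OF zero[of "\<lambda>_ _. 0"] w(3), of _ "-1"])
        (use w in \<open>simp_all add: fox_inv sum_negf\<close>)
    then show "inv\<^bsub>F\<^esub> w \<in> {w. Q w}"
      using w height_inv[OF w(1)] unfolding Q_def by (auto intro!: exI[of _ "\<lambda>i. - a i"])
  next
    fix w w' assume "w \<in> {w. Q w}" "w' \<in> {w. Q w}"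
    then obtain a a' where w: "w \<in> carrier F" "height c w = 0"
      "shift_combination n D (\<lambda>j k. fox c w j k + (\<Sum>i\<in>K. a i * fox c (g i) j k))"
      and w': "w' \<in> carrier F" "height c w' = 0"
      "shift_combination n D (\<lambda>j k. fox c w' j k + (\<Sum>i\<in>K. a' i * fox c (g i) j k))"
      by (auto simp: Q_def)
    have "shift_combination n D
      (\<lambda>j k. fox c (w \<otimes>\<^bsub>F\<^esub> w') j k + (\<Sum>i\<in>K. (a i + a' i) * fox c (g i) j k))"
      by (rule lin[OF w(3) w'(3), of _ 1])
        (use w in \<open>simp add: F_def fox_append distrib_right sum.distrib\<close>)
    moreover have "w \<otimes>\<^bsub>F\<^esub> w' \<in> carrier F" using w w' by simp
    ultimately show "w \<otimes>\<^bsub>F\<^esub> w' \<in> {w. Q w}"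
      using w w' unfolding Q_def by (auto simp: F_def intro!: exI[of _ "\<lambda>i. a i + a' i"])
  qed
  ultimately have "generate F (normal_closure F (set rs) \<union> g ` K) \<subseteq> {w. Q w}"
    by (intro F.generate_subgroup_incl) auto
  then have allQ: "Q w" if "w \<in> carrier F" "height c w = 0" for w
    using gen that by (auto simp: F_def)

  define m where "m = c s"
  \<comment> \<open>The kernel elements \<open>s^i [s, x 0] s^-i\<close>, with derivative
    \<open>t^((i + 1) m) - t^(i m)\<close> in the variable \<open>x 0\<close>.\<close>
  define y where "y i = reduce (replicate i (s, True) @
    [(s, True), (x 0, True), (s, False), (x 0, False)] @ replicate i (s, False))" for i
  have xX: "x i \<in> X" "x i \<noteq> s" if "i < n" for i using x(2) that by (auto simp: n_def)
  have h_rep: "height c (replicate i (s, b)) = (if b then int i * m else - (int i * m))" for i b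
    by (induction i) (auto simp: letter_height_def m_def algebra_simps)
  have fox_rep: "fox c (replicate i (s, b)) (x j) k = 0" if "j < n" for i b j k
    using xX(2)[OF that] by (induction i arbitrary: k; cases b) auto
  have y_F: "y i \<in> carrier F" for i
  proof -
    have "replicate i (s, b) \<in> words_over X" for b
      using s by (auto simp: in_words_over_iff)
    then show ?thesis
      using s xX[OF n] by (auto simp: y_def F_def carrier_free_group intro!: words_over_reduce)
  qed
  have y_h: "height c (y i) = 0" for i
    by (simp add: y_def h_rep letter_height_def)
  have y_fox: "fox c (y i) (x j) k =
    (if j = 0 then of_bool (k = (int i + 1) * m) - of_bool (k = int i * m) else 0)"
    if "j < n" for i j k
  proof -
    have "x j = x 0 \<longleftrightarrow> j = 0" using x(1) that n by (auto simp: inj_on_def n_def)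
    then show ?thesis
      using xX(2)[OF that] xX(2)[OF n] fox_rep[OF that]
      by (auto simp: y_def fox_append h_rep m_def algebra_simps)
  qed
  have "\<forall>i. \<exists>a. shift_combination n D (\<lambda>j k. fox c (y i) j k + (\<Sum>l\<in>K. a l * fox c (g l) j k))"
    using allQ[OF y_F y_h] by (auto simp: Q_def)
  from choice[OF this] obtain a where a:
    "\<And>i. shift_combination n D (\<lambda>j k. fox c (y i) j k + (\<Sum>l\<in>K. a i l * fox c (g l) j k))"
    by blast
  \<comment> \<open>The coefficients \<open>a i\<close> become vectors in \<open>Z^B\<close>, to
    which \<open>int_vectors_dependent\<close> applies.\<close>
  obtain B where B: "K \<subseteq> {..<B}" using K finite_nat_iff_bounded by blast
  obtain q b where q: "\<forall>l<B. a q l = (\<Sum>i<q. b i * a i l)"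
    using int_vectors_dependent[of B a] by blast
  have part: "shift_combination n D
    (\<lambda>j k. \<Sum>i<t. b i * (fox c (y i) j k + (\<Sum>l\<in>K. a i l * fox c (g l) j k)))" for t
  proof (induction t)
    case (Suc t)
    show ?case by (rule lin[OF Suc a[of t], of _ "b t"]) simp
  qed (simp add: zero)
  \<comment> \<open>The relation among the coefficient vectors cancels all \<open>g l\<close>, so
    this combination lies in the row span.\<close>
  define f where "f j k = fox c (y q) j k - (\<Sum>i<q. b i * fox c (y i) j k)" for j k
  have f: "shift_combination n D f"
  proof (rule lin[OF a[of q] part[of q], of _ "-1"])
    fix j k
    have "(\<Sum>l\<in>K. a q l * fox c (g l) j k) = (\<Sum>l\<in>K. \<Sum>i<q. b i * (a i l * fox c (g l) j k))"
      using B q by (intro sum.cong refl) (auto simp: sum_distrib_right mult.assoc)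
    also have "\<dots> = (\<Sum>i<q. b i * (\<Sum>l\<in>K. a i l * fox c (g l) j k))"
      by (subst sum.swap) (simp add: sum_distrib_left)
    finally show "f j k = fox c (y q) j k + (\<Sum>l\<in>K. a q l * fox c (g l) j k) +
        - 1 * (\<Sum>i<q. b i * (fox c (y i) j k + (\<Sum>l\<in>K. a i l * fox c (g l) j k)))"
      by (simp add: f_def distrib_left sum.distrib)
  qed
  define d where "d = (int q + 1) * m"
  have m: "m > 0" using s by (simp add: m_def)
  have low: "(int i + 1) * m < k" "int i * m < k" if "i < q" "k \<ge> d" for i k
  proof -
    have "(int i + 1) * m < (int q + 1) * m" using that m by (intro mult_strict_right_mono) auto
    then show "(int i + 1) * m < k" using that by (simp add: d_def)
    then show "int i * m < k" using m by (simp add: algebra_simps)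
  qed
  \<comment> \<open>Only \<open>y q\<close> reaches degree \<open>d\<close>, with coefficient 1: the
    earlier \<open>y i\<close> have degree at most \<open>(i + 1) * m\<close>.\<close>
  have f_top: "f (x j) k = (if j = 0 \<and> k = d then 1 else 0)" if "j < n" "k \<ge> d" for j k
  proof -
    have "(\<Sum>i<q. b i * fox c (y i) (x j) k) = 0"
      using low that y_fox[OF that(1)] by (intro sum.neutral) force
    moreover have "int q * m < d" using m by (simp add: d_def algebra_simps)
    ultimately show ?thesis using y_fox[OF that(1)] that by (auto simp: f_def d_def)
  qed
  define h where "h i = height c (u i) + 2 * m" for i
  \<comment> \<open>The paths of \<open>u i\<close> and \<open>v i\<close> stay at height at most
    \<open>height c (u i)\<close>, so from \<open>h i\<close> upwards only the inserted word
    contributes.\<close>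
  have D_top: "D i (x j) k = (if i = j \<and> k = h i then 2 else 0)"
    if ij: "i < n" "j < n" and k: "k \<ge> h i" for i j k
  proof -
    have i: "i < length rs" using ij by (simp add: n_def)
    have "fox c (u i) (x j) k = 0"
      using u[OF i] k m by (intro fox_eq_0) (force simp: h_def)
    moreover have "fox c (v i) (x j) (k - height c (u i)) = 0"
      using v[OF i] k m by (intro fox_eq_0) (force simp: h_def)
    moreover have "x j = x i \<longleftrightarrow> i = j" using x(1) ij by (auto simp: inj_on_def n_def)
    moreover have "x j \<noteq> s" using xX ij by auto
    ultimately show ?thesis
      using k m s by (auto simp: D_def r[OF i] fox_append fox_insertion h_def m_def)
  qed
  have "even (f (x 0) d)"
    by (rule shift_combination_top_even[OF f, of h])
      (use D_top f_top n in auto)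
  then show False using f_top[OF n, of d] by simp
qed

section \<open>Parity of exponent sums and uniqueness of the height function\<close>

lemma height_lincomb: "height (\<lambda>i. a * c i + b * d i) w = a * height c w + b * height d w"
  by (induction w) (auto simp: letter_height_def algebra_simps)

abbreviation exponent :: "'a \<Rightarrow> 'a word \<Rightarrow> int" where
  "exponent j \<equiv> height (\<lambda>i. of_bool (i = j))"

lemma exponent_eq_0: "j \<notin> fst ` set w \<Longrightarrow> exponent j w = 0"
  by (induction w) (auto simp: letter_height_def)

lemma height_eq_sum:
  assumes "finite X" "w \<in> words_over X"
  shows "height c w = (\<Sum>j\<in>X. c j * exponent j w)"
  using assms(2)
proof (induction w)
  case (Cons a w)
  have "(\<Sum>j\<in>X. c j * letter_height (\<lambda>i. of_bool (i = j)) a) = letter_height c a"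
    using Cons.prems assms(1)
    by (subst sum.mono_neutral_cong_right[of _ "{fst a}" _ "\<lambda>_. letter_height c a"])
      (auto simp: letter_height_def)
  then show ?case using Cons by (simp add: distrib_left sum.distrib)
qed simp

lemma height_proportional:
  assumes "w \<in> words_over X" "\<And>j. j \<in> X \<Longrightarrow> a * c j = b * d j"
  shows "a * height c w = b * height d w"
  using assms(1)
proof (induction w)
  case (Cons x w)
  have "a * letter_height c x = b * letter_height d x"
    using Cons.prems assms(2)[of "fst x"] by (auto simp: letter_height_def)
  then show ?case using Cons by (simp add: distrib_left)
qed simp

text \<open>The exponent matrix is \<open>(I | 0)\<close> modulo 2. Relators are numbered from 0 and
  generators from 1, hence \<open>Suc i\<close>.\<close>

definition parity_normal :: "nat \<Rightarrow> nat word list \<Rightarrow> bool" where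
  "parity_normal n rs \<longleftrightarrow> (\<forall>i<n. \<forall>j\<in>{1..n+1}. odd (exponent j (rs ! i)) \<longleftrightarrow> j = Suc i)"

text \<open>Infinite descent: a solution vanishing at \<open>n + 1\<close> is divisible by every power of \<open>2\<close>.\<close>

lemma parity_normal_unique:
  assumes rs: "rs \<in> relator_tuples n l" and par: "parity_normal n rs"
    and h: "\<And>i. i < n \<Longrightarrow> height c (rs ! i) = 0" and s: "c (n + 1) = 0" and j: "j \<in> {1..n+1}"
  shows "c j = 0"
proof -
  have W: "rs ! i \<in> words_over {1..n+1}" if "i < n" for i
    using rs that by (auto simp: relator_tuples_def)
  have "\<forall>j\<in>{1..n+1}. 2 ^ k dvd c j" for k
  proof (induction k)
    case (Suc k)
    define c' where "c' j = c j div 2 ^ k" for j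
    have c': "c j = 2 ^ k * c' j" if "j \<in> {1..n+1}" for j
      using Suc that by (simp add: c'_def)
    \<comment> \<open>Relator \<open>i\<close> with \<open>j = Suc i\<close> has an odd exponent sum
      only in \<open>j\<close>, so its equation modulo 2 isolates \<open>c' j\<close>.\<close>
    have "even (c' j)" if j: "j \<in> {1..n+1}" for j
    proof (cases "j = n + 1")
      case True
      then show ?thesis using c'[OF j] s by simp
    next
      case False
      then obtain i where i: "i < n" "j = Suc i" using j by (cases j) auto
      have "0 = (\<Sum>j\<in>{1..n+1}. c j * exponent j (rs ! i))"
        using height_eq_sum[OF _ W[OF i(1)], of c] h[OF i(1)] by simp
      also have "\<dots> = 2 ^ k * (\<Sum>j\<in>{1..n+1}. c' j * exponent j (rs ! i))"
        unfolding sum_distrib_left by (rule sum.cong) (auto simp: c')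
      finally have "0 = (\<Sum>j\<in>{1..n+1}. c' j * exponent j (rs ! i))" by simp
      also have "\<dots> = c' j * exponent j (rs ! i) +
          (\<Sum>j\<in>{1..n+1} - {j}. c' j * exponent j (rs ! i))"
        using j by (subst sum.remove[of _ j]) auto
      finally have "c' j * exponent j (rs ! i) =
          - (\<Sum>j\<in>{1..n+1} - {j}. c' j * exponent j (rs ! i))" by simp
      moreover have "even (\<Sum>j\<in>{1..n+1} - {j}. c' j * exponent j (rs ! i))"
        using par i by (intro dvd_sum) (auto simp: parity_normal_def)
      ultimately have "even (c' j * exponent j (rs ! i))" by simp
      moreover have "odd (exponent j (rs ! i))"
        using par i j unfolding parity_normal_def by blast
      ultimately show ?thesis by simp
    qed
    then show ?case using c' by (auto simp: mult.commute)
  qed simp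
  then have "2 ^ nat \<bar>c j\<bar> dvd c j" using j by blast
  moreover have "\<bar>c j\<bar> < 2 ^ nat \<bar>c j\<bar>"
    using of_nat_less_two_power[of "nat \<bar>c j\<bar>"] by (metis abs_ge_zero int_nat_eq)
  ultimately show ?thesis
    using dvd_imp_le_int[of "c j" "2 ^ nat \<bar>c j\<bar>"] by force
qed

text \<open>One height function suffices here: by parity normality every other one vanishing on the
  relators is proportional to it on the generators.\<close>

definition bad_tuple :: "nat \<Rightarrow> nat word list \<Rightarrow> bool" where
  "bad_tuple n rs \<longleftrightarrow> parity_normal n rs \<and>
    (\<exists>c u v. c (n + 1) > 0 \<and> (\<forall>i<n. height c (rs ! i) = 0 \<and>
       rs ! i = u i @ insertion (n + 1) (Suc i) @ v i \<and>
       (\<forall>p q. u i = p @ q \<longrightarrow> height c p \<le> height c (u i)) \<and>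
       (\<forall>p q. v i = p @ q \<longrightarrow> height c p \<le> 0)))"

text \<open>Up to sign, \<open>d\<close> is a positive multiple of the given \<open>c\<close>, so
  points of maximal height for \<open>c\<close> remain maximal and the kernel is unchanged.\<close>

lemma bad_tuple_kernel_not_finitely_generated:
  fixes n :: nat and d :: "nat \<Rightarrow> int" and K :: "nat set" and g :: "nat \<Rightarrow> nat word"
  defines "X \<equiv> {1..n+1}"
  assumes n: "n \<ge> 1" and rs: "rs \<in> relator_tuples n l" and bad: "bad_tuple n rs"
    and d0: "\<And>r. r \<in> set rs \<Longrightarrow> height d r = 0"
    and dX: "\<exists>x\<in>X. d x \<noteq> 0" and K: "finite K"
    and g: "\<And>i. i \<in> K \<Longrightarrow> g i \<in> carrier (free_group X) \<and> height d (g i) = 0"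
    and gen: "\<And>w. w \<in> carrier (free_group X) \<Longrightarrow> height d w = 0 \<Longrightarrow>
       w \<in> generate (free_group X) (normal_closure (free_group X) (set rs) \<union> g ` K)"
  shows False
proof -
  define s where "s = n + 1"
  have len: "length rs = n" using rs by (simp add: relator_tuples_def)
  have W: "rs ! i \<in> words_over X" if "i < n" for i
    using rs that by (auto simp: relator_tuples_def X_def)
  have R: "set rs \<subseteq> carrier (free_group X)"
    using rs by (auto simp: relator_tuples_def carrier_free_group cyclically_reduced_def X_def)
  obtain c u v where par: "parity_normal n rs" and cs: "c s > 0"
    and *: "\<forall>i<n. height c (rs ! i) = 0 \<and> rs ! i = u i @ insertion s (Suc i) @ v i \<and>
      (\<forall>p q. u i = p @ q \<longrightarrow> height c p \<le> height c (u i)) \<and>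
      (\<forall>p q. v i = p @ q \<longrightarrow> height c p \<le> 0)"
    using bad unfolding bad_tuple_def s_def by (elim conjE exE)
  have c0: "height c (rs ! i) = 0" and r: "rs ! i = u i @ insertion s (Suc i) @ v i"
    and u: "\<And>p q. u i = p @ q \<Longrightarrow> height c p \<le> height c (u i)"
    and v: "\<And>p q. v i = p @ q \<Longrightarrow> height c p \<le> 0" if "i < n" for i
    using *[rule_format, OF that] by blast+
  have d0': "height d (rs ! i) = 0" if "i < n" for i using d0 that len by auto
  have ds: "d s \<noteq> 0"
    using parity_normal_unique[OF rs par, of d] d0' dX by (auto simp: X_def s_def)
  \<comment> \<open>The difference of the two sides is a height function vanishing on the relators
    and at \<open>s\<close>, hence zero.\<close>
  have scaled: "c s * d j = d s * c j" if "j \<in> X" for j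
  proof -
    have "height (\<lambda>j. c s * d j + (- d s) * c j) (rs ! i) = 0" if "i < n" for i
      unfolding height_lincomb using that by (simp add: c0 d0')
    then have "c s * d j + (- d s) * c j = 0"
      using parity_normal_unique[OF rs par, of "\<lambda>j. c s * d j + (- d s) * c j" j] that
      by (simp add: X_def s_def)
    then show ?thesis by simp
  qed
  \<comment> \<open>The sign makes \<open>e s\<close> positive; the zero summand fits the form of
    \<open>height_lincomb\<close>.\<close>
  define e where "e j = sgn (d s) * d j + 0 * d j" for j
  have he: "height e w = sgn (d s) * height d w" for w
    unfolding e_def[abs_def] height_lincomb by simp
  have es: "e s > 0" using ds by (auto simp: e_def sgn_if)
  have heights: "c s * height e w = \<bar>d s\<bar> * height c w" if "w \<in> words_over X" for w
    using height_proportional[OF that scaled] unfolding he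
    by (simp add: abs_sgn algebra_simps)
  have le: "height e p \<le> height e q"
    if "p \<in> words_over X" "q \<in> words_over X" "height c p \<le> height c q" for p q
  proof -
    have "c s * height e p \<le> c s * height e q"
      using that by (simp add: heights mult_left_mono)
    then show ?thesis using cs by simp
  qed
  have uvX: "u i \<in> words_over X" "v i \<in> words_over X" if "i < n" for i
    using W[OF that] unfolding r[OF that] by simp_all
  show False
  proof (rule kernel_not_finitely_generated[where c = e and s = s and X = X and rs = rs and x = Suc and K = K
        and u = u and v = v and g = g])
    fix i p q assume i: "i < length rs" and p: "u i = p @ q"
    have "p \<in> words_over X" using uvX[of i] i len p by simp
    moreover have "height c p \<le> height c (u i)" "u i \<in> words_over X"
      using u[OF _ p] uvX i len by auto
    ultimately show "height e p \<le> height e (u i)" by (intro le)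
  next
    fix i p q assume i: "i < length rs" and p: "v i = p @ q"
    have "p \<in> words_over X" using uvX[of i] i len p by simp
    then show "height e p \<le> 0"
      using le[of p "[]"] v[of i p q] uvX[of i] i len p by simp
  next
    show "Suc ` {..<length rs} \<subseteq> X - {s}" by (auto simp: len X_def s_def)
    show "rs \<noteq> []" using n len by auto
    show "rs ! i = u i @ insertion s (Suc i) @ v i" if "i < length rs" for i
      using r that len by simp
    show "height e r = 0" if "r \<in> set rs" for r using d0[OF that] by (simp add: he)
    show "g i \<in> carrier (free_group X) \<and> height e (g i) = 0" if "i \<in> K" for i
      using g[OF that] by (simp add: he)
    show "w \<in> generate (free_group X) (normal_closure (free_group X) (set rs) \<union> g ` K)"
      if "w \<in> carrier (free_group X)" "height e w = 0" for w
      using gen[OF that(1)] that(2) ds by (simp add: he sgn_0_0)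
  qed (use es R K in \<open>simp_all add: X_def s_def\<close>)
qed

lemma bad_tuple_not_free_by_cyclic:
  assumes n: "n \<ge> 1" and rs: "rs \<in> relator_tuples n l" and bad: "bad_tuple n rs"
  shows "\<not> free_by_cyclic (deficiency_one_group n rs)"
proof
  assume "free_by_cyclic (deficiency_one_group n rs)"
  then have fbc: "free_by_cyclic (presented_group {1..n+1} (set rs))"
    by (simp add: deficiency_one_group_def)
  have R: "set rs \<subseteq> carrier (free_group {1..n+1})"
    using rs by (auto simp: relator_tuples_def carrier_free_group cyclically_reduced_def)
  show False
  proof (rule free_by_cyclic_presentation[OF fbc R], goal_cases)
    case (1 d K g)
    show ?case
      by (rule bad_tuple_kernel_not_finitely_generated[OF n rs bad, of d K g]) (use 1 in blast)+
  qed
qed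

section \<open>Recoverable insertion at the first point of maximal height\<close>

section \<open>Insertion at the first maximum\<close>

text \<open>Strictness before the cut and weakness after it select the first maximum. They also make
  the last letter of \<open>u\<close> climb and keep the first letter of \<open>v\<close> from
  climbing.\<close>

definition first_max :: "('a \<Rightarrow> int) \<Rightarrow> 'a word \<Rightarrow> 'a word \<Rightarrow> bool" where
  "first_max c u v \<longleftrightarrow>
     (\<forall>p q. u = p @ q \<longrightarrow> q \<noteq> [] \<longrightarrow> height c p < height c u) \<and>
     (\<forall>p q. v = p @ q \<longrightarrow> height c p \<le> 0)"

lemma first_max_prefix_le:
  assumes "first_max c u v" "u @ v = p @ q"
  shows "height c p \<le> height c u"
proof -
  consider t where "u = p @ t" | t where "p = u @ t" "v = t @ q"
    using assms(2) by (auto simp: append_eq_append_conv2)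
  then show ?thesis
  proof cases
    case (1 t)
    then show ?thesis using assms(1) unfolding first_max_def by (cases "t = []") force+
  next
    case 2
    then show ?thesis using assms(1) unfolding first_max_def by force
  qed
qed

lemma ex_first_max: "\<exists>u v. w = u @ v \<and> first_max c u v"
proof (induction w)
  case Nil
  then show ?case by (auto simp: first_max_def)
next
  case (Cons a w)
  then obtain u v where w: "w = u @ v" and m: "first_max c u v" by blast
  show ?case
  proof (cases "letter_height c a + height c u > 0")
    case True
    then have "first_max c (a # u) v"
      using m unfolding first_max_def by (auto simp: Cons_eq_append_conv)
    then show ?thesis using w by (metis append_Cons)
  next
    case False
    have "first_max c [] (a # w)"
      using first_max_prefix_le[OF m] False w
      by (fastforce simp: first_max_def Cons_eq_append_conv)
    then show ?thesis by (metis append_Nil)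
  qed
qed

text \<open>The bound is attained, by \<open>insertion_top\<close>; together they give the exact
  rise of the maximum caused by an insertion.\<close>

lemma height_insertion_prefix_le:
  assumes "c s > 0" "insertion s x = p @ q"
  shows "height c p \<le> 2 * c s + max 0 (c x)"
  using assms unfolding insertion_def by (auto simp: Cons_eq_append_conv letter_height_def)

lemma insertion_top:
  assumes "c s > 0"
  obtains p q where "insertion s x = p @ q" "height c p = 2 * c s + max 0 (c x)"
proof (cases "c x > 0")
  case True
  then show ?thesis
    by (intro that[of "take 3 (insertion s x)" "drop 3 (insertion s x)"])
      (simp_all add: insertion_def letter_height_def)
next
  case False
  then show ?thesis
    by (intro that[of "take 2 (insertion s x)" "drop 2 (insertion s x)"])
      (simp_all add: insertion_def letter_height_def)
qed

text \<open>The maximal height after the insertion determines the maximal height before it.\<close>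

lemma insertion_position_le:
  assumes m: "first_max c u v" "first_max c u' v'" and s: "c s > 0"
    and eq: "u @ insertion s x @ v = u' @ insertion s x @ v'"
  shows "length u' \<le> length u"
proof (rule ccontr)
  assume "\<not> length u' \<le> length u"
  then obtain t where t: "u' = u @ t" "t \<noteq> []"
    using eq by (auto simp: append_eq_append_conv2)
  then have lt: "height c u < height c u'"
    using m(2) unfolding first_max_def by blast
  \<comment> \<open>Read through \<open>u\<close>, the common word never exceeds the old maximum
    plus the top of the inserted word; read through \<open>u'\<close>, it reaches a greater
    height.\<close>
  have bound: "height c p \<le> height c u + (2 * c s + max 0 (c x))"
    if "u @ insertion s x @ v = p @ q" for p q
  proof -
    consider t where "u = p @ t" | t where "p = u @ t" "insertion s x @ v = t @ q"
      using \<open>_ = p @ q\<close> append_eq_append_conv2[of u "insertion s x @ v" p q] by blast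
    then show ?thesis
    proof cases
      case (1 t)
      then show ?thesis using first_max_prefix_le[OF m(1), of p "t @ v"] s by simp
    next
      case (2 t)
      consider t' where "insertion s x = t @ t'" | t' where "t = insertion s x @ t'" "v = t' @ q"
        using 2(2) append_eq_append_conv2[of "insertion s x" v t q] by blast
      then show ?thesis
      proof cases
        case (1 t')
        then show ?thesis using height_insertion_prefix_le[of c s x t t', OF s] 2(1) by simp
      next
        case (2 t')
        then have "height c t' \<le> 0" using m(1) unfolding first_max_def by blast
        then show ?thesis using 2 \<open>p = u @ t\<close> s by simp
      qed
    qed
  qed
  obtain p q where pq: "insertion s x = p @ q" "height c p = 2 * c s + max 0 (c x)"
    using insertion_top[of c s x, OF s] by blast
  have "height c (u' @ p) \<le> height c u + (2 * c s + max 0 (c x))"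
    using eq pq(1) by (intro bound[of _ "q @ v'"]) simp
  then show False using pq(2) lt by simp
qed

lemma insertion_position_unique:
  assumes "first_max c u v" "first_max c u' v'" "c s > 0"
    and eq: "u @ insertion s x @ v = u' @ insertion s x @ v'"
  shows "u @ v = u' @ v'"
proof -
  have "length u = length u'"
    using insertion_position_le[OF assms] insertion_position_le[OF assms(2,1,3) eq[symmetric]]
    by simp
  then show ?thesis using eq by simp
qed

section \<open>Cyclic reducedness after insertion, and insertion into whole tuples\<close>

lemma reduced_append:
  "reduced (u @ v) \<longleftrightarrow>
     reduced u \<and> reduced v \<and> (u \<noteq> [] \<longrightarrow> v \<noteq> [] \<longrightarrow> hd v \<noteq> inv_letter (last u))"
  unfolding reduced_def successively_append_iff by auto

text \<open>The inserted word begins with \<open>s\<close> and ends with its inverse. A climbing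
  last letter of \<open>u\<close> is not the inverse of \<open>s\<close>, and a non-climbing first
  letter of \<open>v\<close> is not \<open>s\<close>, so nothing cancels.\<close>

lemma cyclically_reduced_insertion:
  assumes w: "cyclically_reduced (u @ v)" "u @ v \<noteq> []" "height c (u @ v) = 0"
    and m: "first_max c u v" and s: "c s > 0" and x: "x \<noteq> s"
  shows "cyclically_reduced (u @ insertion s x @ v)"
proof -
  have red: "reduced u" "reduced v"
    using w(1) by (auto simp: cyclically_reduced_def reduced_append)
  have ins: "reduced (insertion s x)"
    using x by (auto simp: insertion_def reduced_Cons inv_letter_def)
  have hd: "insertion s x \<noteq> []" "hd (insertion s x) = (s, True)" "last (insertion s x) = (s, False)"
    by (auto simp: insertion_def)
  have lasts: "last u \<noteq> (s, False)" if "u \<noteq> []"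
  proof -
    obtain b a where u: "u = b @ [a]" using \<open>u \<noteq> []\<close> by (cases u rule: rev_cases) auto
    then have "height c b < height c u" using m unfolding first_max_def by blast
    then have "letter_height c a > 0" using u by simp
    then show ?thesis using s u by (auto simp: letter_height_def)
  qed
  have hds: "hd v \<noteq> (s, True)" if "v \<noteq> []"
  proof -
    have "height c [hd v] \<le> 0"
      using m that unfolding first_max_def by (metis append_Cons append_Nil list.collapse)
    then show ?thesis using s by (auto simp: letter_height_def)
  qed
  \<comment> \<open>With \<open>v\<close> empty the maximum is \<open>height c u = 0\<close>, so the
    first letter cannot climb.\<close>
  have hdu: "hd u \<noteq> (s, True)" if "v = []"
  proof -
    have "height c [hd u] \<le> height c u"
      using first_max_prefix_le[OF m, of "[hd u]" "tl u"] that w(2) by simp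
    then show ?thesis using s w(3) that by (auto simp: letter_height_def)
  qed
  \<comment> \<open>With \<open>u\<close> empty the maximum is 0, and the last letter returns to
    height 0 from at most 0, so it cannot descend.\<close>
  have lastv: "last v \<noteq> (s, False)" if "u = []"
  proof -
    have v: "v = butlast v @ [last v]" using that w(2) by simp
    then have "height c (butlast v) \<le> 0" using m unfolding first_max_def by blast
    moreover have "height c (butlast v) + letter_height c (last v) = 0"
      using w(3) that v by (metis append_Nil height_append height_Cons height_Nil add.right_neutral)
    ultimately show ?thesis using s by (auto simp: letter_height_def)
  qed
  have "reduced (u @ insertion s x @ v)"
    using red ins hd lasts hds
    by (auto simp: reduced_append hd_append inv_letter_def prod_eq_iff)
  moreover have "hd (u @ insertion s x @ v) \<noteq> inv_letter (last (u @ insertion s x @ v))"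
  proof (cases "u = [] \<or> v = []")
    case True
    then show ?thesis using hd hdu lastv w(2)
      by (auto simp: hd_append last_append inv_letter_def prod_eq_iff)
  next
    case False
    then show ?thesis using w(1) by (auto simp: cyclically_reduced_def hd_append last_append)
  qed
  ultimately show ?thesis by (simp add: cyclically_reduced_def)
qed

text \<open>There are \<open>n\<close> equations in \<open>n + 1\<close> unknowns; parity forces a
  nonzero solution to be nonzero at \<open>n + 1\<close>, and a sign makes it positive
  there.\<close>

lemma ex_positive_heights:
  assumes rs: "rs \<in> relator_tuples n l" and par: "parity_normal n rs"
  shows "\<exists>c. c (n + 1) > 0 \<and> (\<forall>i<n. height c (rs ! i) = 0)"
proof -
  obtain c where c: "\<exists>j\<in>{1..n+1}. c j \<noteq> 0"
      "\<forall>i<n. (\<Sum>j\<in>{1..n+1}. c j * exponent j (rs ! i)) = 0"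
    using homogeneous_system_solution[of "{1..n+1}" n "\<lambda>i j. exponent j (rs ! i)"] by auto
  have h: "height c (rs ! i) = 0" if "i < n" for i
    using height_eq_sum[of "{1..n+1}" "rs ! i" c] c(2) rs that
    by (auto simp: relator_tuples_def)
  then have s: "c (n + 1) \<noteq> 0" using parity_normal_unique[OF rs par, of c] c(1) by blast
  have "height (\<lambda>j. sgn (c (n + 1)) * c j + 0 * c j) (rs ! i) = 0" if "i < n" for i
    unfolding height_lincomb using h[OF that] by simp
  then show ?thesis
    using s by (intro exI[of _ "\<lambda>j. sgn (c (n + 1)) * c j + 0 * c j"]) (auto simp: sgn_if)
qed

definition heights_of :: "nat \<Rightarrow> nat word list \<Rightarrow> nat \<Rightarrow> int" where
  "heights_of n rs = (SOME c. c (n + 1) > 0 \<and> (\<forall>i<n. height c (rs ! i) = 0))"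

definition split_at_max :: "('a \<Rightarrow> int) \<Rightarrow> 'a word \<Rightarrow> 'a word \<times> 'a word" where
  "split_at_max c w = (SOME p. w = fst p @ snd p \<and> first_max c (fst p) (snd p))"

definition insert_at_max :: "('a \<Rightarrow> int) \<Rightarrow> 'a \<Rightarrow> 'a \<Rightarrow> 'a word \<Rightarrow> 'a word" where
  "insert_at_max c s x w = fst (split_at_max c w) @ insertion s x @ snd (split_at_max c w)"

definition insert_tuple :: "nat \<Rightarrow> nat word list \<Rightarrow> nat word list" where
  "insert_tuple n rs =
     map (\<lambda>i. insert_at_max (heights_of n rs) (n + 1) (Suc i) (rs ! i)) [0..<n]"

lemma split_at_max:
  "w = fst (split_at_max c w) @ snd (split_at_max c w)"
  "first_max c (fst (split_at_max c w)) (snd (split_at_max c w))"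
proof -
  have "\<exists>p. w = fst p @ snd p \<and> first_max c (fst p) (snd p)"
    using ex_first_max[of w c] by auto
  from someI_ex[OF this]
  show "w = fst (split_at_max c w) @ snd (split_at_max c w)"
    "first_max c (fst (split_at_max c w)) (snd (split_at_max c w))"
    by (auto simp: split_at_max_def)
qed

lemma height_insert_at_max [simp]: "height d (insert_at_max c s x w) = height d w"
proof -
  have "height d w = height d (fst (split_at_max c w) @ snd (split_at_max c w))"
    using split_at_max(1)[of w c] by simp
  then show ?thesis by (simp add: insert_at_max_def)
qed

text \<open>Inserted words have height 0 for every \<open>c\<close>, so the choice ranges over the
  same functions and can be recovered from the image.\<close>

lemma heights_of_insert_tuple: "heights_of n (insert_tuple n rs) = heights_of n rs"
proof -
  have "(\<forall>i<n. height c (insert_tuple n rs ! i) = 0) \<longleftrightarrow> (\<forall>i<n. height c (rs ! i) = 0)" for c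
    by (simp add: insert_tuple_def)
  then show ?thesis unfolding heights_of_def by simp
qed

lemma heights_of:
  assumes "rs \<in> relator_tuples n l" "parity_normal n rs"
  shows "heights_of n rs (n + 1) > 0" "\<And>i. i < n \<Longrightarrow> height (heights_of n rs) (rs ! i) = 0"
  using someI_ex[OF ex_positive_heights[OF assms]] unfolding heights_of_def by auto

text \<open>The inserted word has ten letters and exponent sum 0 in every generator, so parities and
  heights survive.\<close>

lemma insert_tuple_bad:
  assumes rs: "rs \<in> relator_tuples n l" and par: "parity_normal n rs"
  shows "insert_tuple n rs \<in> relator_tuples n (l + 10)" "bad_tuple n (insert_tuple n rs)"
proof -
  define c where "c = heights_of n rs"
  define u where "u i = fst (split_at_max c (rs ! i))" for i
  define v where "v i = snd (split_at_max c (rs ! i))" for i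
  have c: "c (n + 1) > 0" "\<And>i. i < n \<Longrightarrow> height c (rs ! i) = 0"
    unfolding c_def using heights_of[OF assms] by auto
  have r: "rs ! i = u i @ v i" and m: "first_max c (u i) (v i)" for i
    unfolding u_def v_def using split_at_max by auto
  have len: "length (insert_tuple n rs) = n" by (simp add: insert_tuple_def)
  have nth: "insert_tuple n rs ! i = u i @ insertion (n + 1) (Suc i) @ v i" if "i < n" for i
    using that by (simp add: insert_tuple_def insert_at_max_def u_def v_def c_def)
  have "insert_tuple n rs ! i \<in> words_over {1..n+1} \<and> insert_tuple n rs ! i \<noteq> [] \<and>
      cyclically_reduced (insert_tuple n rs ! i) \<and> length (insert_tuple n rs ! i) \<le> l + 10"
    if i: "i < n" for i
  proof -
    have ri: "rs ! i \<in> words_over {1..n+1}" "rs ! i \<noteq> []" "cyclically_reduced (rs ! i)"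
      "length (rs ! i) \<le> l"
      using rs i by (auto simp: relator_tuples_def)
    have "cyclically_reduced (u i @ insertion (n + 1) (Suc i) @ v i)"
      by (rule cyclically_reduced_insertion[of _ _ c]) (use ri c i m in \<open>auto simp flip: r\<close>)
    moreover have "u i \<in> words_over {1..n+1}" "v i \<in> words_over {1..n+1}"
      using ri(1) unfolding r by simp_all
    moreover have "length (u i) + length (v i) \<le> l" using ri(4) unfolding r by simp
    ultimately show ?thesis using i by (simp add: nth insertion_def)
  qed
  then show "insert_tuple n rs \<in> relator_tuples n (l + 10)"
    using len by (auto simp: relator_tuples_def in_set_conv_nth)
  have par': "parity_normal n (insert_tuple n rs)"
    using par by (simp add: parity_normal_def nth r)
  have u: "height c p \<le> height c (u i)" if "u i = p @ q" for i p q
    using first_max_prefix_le[OF m, of i p "q @ v i"] that by simp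
  have v: "height c p \<le> 0" if "v i = p @ q" for i p q
    using m[of i] that unfolding first_max_def by blast
  have h: "height c (insert_tuple n rs ! i) = 0" if "i < n" for i
    using c(2)[OF that] that by (simp add: nth r)
  show "bad_tuple n (insert_tuple n rs)"
    unfolding bad_tuple_def
  proof (rule conjI[OF par'], rule exI[of _ c], rule exI[of _ u], rule exI[of _ v],
      intro conjI allI impI)
  qed (rule c(1), rule h, assumption, rule nth, assumption, erule u, erule v)
qed

text \<open>The image determines the height function, and this determines the place of insertion in
  each relator.\<close>

lemma inj_on_insert_tuple: "inj_on (insert_tuple n) {rs \<in> relator_tuples n l. parity_normal n rs}"
proof (rule inj_onI)
  fix rs rs' assume rs: "rs \<in> {rs \<in> relator_tuples n l. parity_normal n rs}"
    and rs': "rs' \<in> {rs \<in> relator_tuples n l. parity_normal n rs}"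
    and eq: "insert_tuple n rs = insert_tuple n rs'"
  define c where "c = heights_of n rs"
  have c': "c = heights_of n rs'"
    unfolding c_def using eq heights_of_insert_tuple by metis
  have c: "c (n + 1) > 0" unfolding c_def using rs heights_of(1) by blast
  show "rs = rs'"
  proof (rule nth_equalityI)
    show "length rs = length rs'" using rs rs' by (auto simp: relator_tuples_def)
    fix i assume "i < length rs"
    then have i: "i < n" using rs by (auto simp: relator_tuples_def)
    have "insert_tuple n rs ! i = insert_tuple n rs' ! i" using eq by simp
    then have "insert_at_max c (n + 1) (Suc i) (rs ! i) = insert_at_max c (n + 1) (Suc i) (rs' ! i)"
      using i by (simp add: insert_tuple_def c_def[symmetric] c'[symmetric])
    then have "fst (split_at_max c (rs ! i)) @ snd (split_at_max c (rs ! i)) =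
        fst (split_at_max c (rs' ! i)) @ snd (split_at_max c (rs' ! i))"
      unfolding insert_at_max_def
      by (rule insertion_position_unique[where c = c, rotated 3]) (rule split_at_max(2) c)+
    then show "rs ! i = rs' ! i" by (simp flip: split_at_max(1))
  qed
qed

section \<open>Positive proportion of parity-normal tuples by bounded changes of suffixes\<close>

section \<open>Counting\<close>

text \<open>One copy of the letter flips the parity of the exponent sum of \<open>j\<close> and two
  copies preserve it, so either target is reachable.\<close>

lemma reduced_append_replicate:
  assumes "reduced w" "w \<noteq> [] \<Longrightarrow> last w \<noteq> (j, \<not> b)"
  obtains k where "k \<in> {1, 2 :: nat}" "reduced (w @ replicate k (j, b))"
    "odd (exponent j (w @ replicate k (j, b))) \<longleftrightarrow> T"
proof -
  define k where "k = (if odd (exponent j w) \<longleftrightarrow> T then 2 else 1 :: nat)"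
  have rep: "replicate k (j, b) = (if k = 1 then [(j, b)] else [(j, b), (j, b)])"
    by (auto simp: k_def numeral_2_eq_2)
  show thesis
  proof (rule that[of k])
    show "reduced (w @ replicate k (j, b))"
      using assms unfolding rep reduced_append
      by (auto simp: reduced_Cons inv_letter_def prod_eq_iff)
    show "odd (exponent j (w @ replicate k (j, b))) \<longleftrightarrow> T"
      unfolding rep by (auto simp: k_def letter_height_def)
  qed (simp add: k_def)
qed

lemma exponent_append_replicate_neq: "i \<noteq> j \<Longrightarrow> exponent i (w @ replicate k (j, b)) = exponent i w"
  by (simp add: exponent_eq_0 set_replicate_conv_if)

text \<open>The generators are corrected in turn; a block in one generator leaves the other parities
  alone. The clause on the last letter permits either sign for a block in generator
  \<open>m + 1\<close>.\<close>

lemma ex_parity_extension: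
  assumes "reduced w"
  shows "\<exists>z. length z \<le> 2 * m \<and> z \<in> words_over {1..m} \<and> reduced (w @ z) \<and>
    (\<forall>j\<in>{1..m}. odd (exponent j (w @ z)) \<longleftrightarrow> T j) \<and> (m > 0 \<longrightarrow> z \<noteq> [] \<and> fst (last z) = m)"
proof (induction m)
  case 0
  then show ?case using assms by (auto intro!: exI[of _ "[]"])
next
  case (Suc m)
  then obtain z where z: "length z \<le> 2 * m" "z \<in> words_over {1..m}" "reduced (w @ z)"
    "\<forall>j\<in>{1..m}. odd (exponent j (w @ z)) \<longleftrightarrow> T j" by blast
  define b where "b = (if w @ z \<noteq> [] \<and> last (w @ z) = (Suc m, False) then False else True)"
  obtain k where k: "k \<in> {1, 2}" "reduced ((w @ z) @ replicate k (Suc m, b))"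
    "odd (exponent (Suc m) ((w @ z) @ replicate k (Suc m, b))) \<longleftrightarrow> T (Suc m)"
    by (rule reduced_append_replicate[OF z(3), of "Suc m" b "T (Suc m)"]) (auto simp: b_def)
  have "odd (exponent j ((w @ z) @ replicate k (Suc m, b))) \<longleftrightarrow> T j" if "j \<in> {1..Suc m}" for j
  proof (cases "j = Suc m")
    case False
    then show ?thesis using that z(4) exponent_append_replicate_neq[OF False] by auto
  qed (use k in simp)
  moreover have "z \<in> words_over {1..Suc m}" using z(2) by (auto simp: in_words_over_iff)
  ultimately show ?case
    using k(1,2) z(1)
    by (intro exI[of _ "z @ replicate k (Suc m, b)"]) (auto simp: in_words_over_iff)
qed

lemma ex_cyclically_reduced_extension:
  assumes n: "n \<ge> 1" and w: "reduced w" "w \<in> words_over {1..n+1}"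
  shows "\<exists>z. length z \<le> 2 * n + 2 \<and> z \<in> words_over {1..n+1} \<and> w @ z \<noteq> [] \<and>
    cyclically_reduced (w @ z) \<and> (\<forall>j\<in>{1..n+1}. odd (exponent j (w @ z)) \<longleftrightarrow> T j)"
proof -
  obtain z where z: "length z \<le> 2 * n" "z \<in> words_over {1..n}" "reduced (w @ z)"
    "\<forall>j\<in>{1..n}. odd (exponent j (w @ z)) \<longleftrightarrow> T j" "z \<noteq> []" "fst (last z) = n"
    using ex_parity_extension[OF w(1), of n T] n by auto
  \<comment> \<open>As \<open>z\<close> ends in generator \<open>n\<close>, the sign of the final
    block is free; it is chosen against cyclic cancellation with the first letter of
    \<open>w\<close>.\<close>
  define b where "b = (if w \<noteq> [] \<and> hd w = (n + 1, False) then False else True)"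
  have last: "last (w @ z) \<noteq> (n + 1, \<not> b)" using z(5,6) by (cases "last z") auto
  obtain k where k: "k \<in> {1, 2}" "reduced ((w @ z) @ replicate k (n + 1, b))"
    "odd (exponent (n + 1) ((w @ z) @ replicate k (n + 1, b))) \<longleftrightarrow> T (n + 1)"
    by (rule reduced_append_replicate[OF z(3) last, of "T (n + 1)"])
  have "odd (exponent j ((w @ z) @ replicate k (n + 1, b))) \<longleftrightarrow> T j" if "j \<in> {1..n+1}" for j
  proof (cases "j = n + 1")
    case False
    then show ?thesis using that z(4) exponent_append_replicate_neq[OF False] by auto
  qed (use k in simp)
  moreover have "z \<in> words_over {1..n+1}" using z(2) by (auto simp: in_words_over_iff)
  moreover have "cyclically_reduced ((w @ z) @ replicate k (n + 1, b))"
  proof -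
    have "hd z \<in> set z" using z(5) by simp
    then have "fst (hd z) \<in> {1..n}" using z(2) by (auto simp: in_words_over_iff)
    then have "hd (w @ z) \<noteq> (n + 1, \<not> b)" by (auto simp: hd_append b_def)
    moreover have "last ((w @ z) @ replicate k (n + 1, b)) = (n + 1, b)" using k(1) by auto
    moreover have "hd ((w @ z) @ replicate k (n + 1, b)) = hd (w @ z)" using z(5) by (simp add: hd_append)
    ultimately show ?thesis
      using k(2) by (simp add: cyclically_reduced_def inv_letter_def)
  qed
  ultimately show ?thesis
    using k(1) z(1,5)
    by (intro exI[of _ "z @ replicate k (n + 1, b)"]) (auto simp: in_words_over_iff)
qed

text \<open>Each tuple is recovered from a shorter parity-normal one and, for each relator, the
  added and the removed suffix. These suffixes range over a finite set independent of
  \<open>l\<close>.\<close>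

lemma card_relator_tuples_le:
  assumes n: "n \<ge> 1"
  shows "\<exists>K. \<forall>l \<ge> 2 * n + 12. card (relator_tuples n l) \<le>
    card {rs \<in> relator_tuples n (l - 10). parity_normal n rs} * K"
proof -
  define X where "X = {1..n+1}"
  \<comment> \<open>Cutting \<open>C\<close> letters and adding at most \<open>2 * n + 2\<close>
    leaves room for the ten inserted letters.\<close>
  define C where "C = 2 * n + 12"
  define W where "W = {w :: nat word. set w \<subseteq> X \<times> UNIV \<and> length w \<le> C}"
  define Q where "Q = {qs. set qs \<subseteq> W \<times> W \<and> length qs = n}"
  define P where "P l = {rs \<in> relator_tuples n (l - 10). parity_normal n rs}" for l
  define \<Phi> where "\<Phi> = (\<lambda>(ys :: nat word list, qs :: (nat word \<times> nat word) list).
    map (\<lambda>i. take (length (ys ! i) - length (fst (qs ! i))) (ys ! i) @ snd (qs ! i)) [0..<n])"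
  have finQ: "finite Q"
    unfolding Q_def W_def
    by (intro finite_lists_length_eq finite_cartesian_product finite_lists_length_le) (simp_all add: X_def)
  have "relator_tuples n l \<subseteq> \<Phi> ` (P l \<times> Q)" if l: "l \<ge> C" for l
  proof
    fix rs assume rs: "rs \<in> relator_tuples n l"
    \<comment> \<open>By truncated subtraction, a relator shorter than \<open>C\<close> is removed
      entirely and \<open>w i\<close> is empty.\<close>
    define w where "w i = take (length (rs ! i) - C) (rs ! i)" for i
    define d where "d i = drop (length (rs ! i) - C) (rs ! i)" for i
    have wd: "w i @ d i = rs ! i" for i by (simp add: w_def d_def)
    have ri: "rs ! i \<in> words_over X" "reduced (rs ! i)" "length (rs ! i) \<le> l" if "i < n" for i
      using rs that by (auto simp: relator_tuples_def cyclically_reduced_def X_def)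
    have wi: "reduced (w i)" "w i \<in> words_over X" "d i \<in> words_over X" if "i < n" for i
      using ri(1,2)[OF that] by (auto simp flip: wd simp: reduced_append)
    have "\<forall>i. \<exists>z. i < n \<longrightarrow> length z \<le> 2 * n + 2 \<and> z \<in> words_over X \<and> w i @ z \<noteq> [] \<and>
        cyclically_reduced (w i @ z) \<and> (\<forall>j\<in>X. odd (exponent j (w i @ z)) \<longleftrightarrow> j = Suc i)"
    proof
      fix i
      show "\<exists>z. i < n \<longrightarrow> length z \<le> 2 * n + 2 \<and> z \<in> words_over X \<and> w i @ z \<noteq> [] \<and>
          cyclically_reduced (w i @ z) \<and> (\<forall>j\<in>X. odd (exponent j (w i @ z)) \<longleftrightarrow> j = Suc i)"
      proof (cases "i < n")
        case True
        show ?thesis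
          using ex_cyclically_reduced_extension[OF n wi(1,2)[OF True, unfolded X_def],
              of "\<lambda>j. j = Suc i"]
          unfolding X_def[symmetric] by (elim exE) (rule exI, rule impI, assumption)
      qed simp
    qed
    from choice[OF this] obtain z where
      z': "\<forall>i. i < n \<longrightarrow> length (z i) \<le> 2 * n + 2 \<and> z i \<in> words_over X \<and> w i @ z i \<noteq> [] \<and>
        cyclically_reduced (w i @ z i) \<and> (\<forall>j\<in>X. odd (exponent j (w i @ z i)) \<longleftrightarrow> j = Suc i)"
      by (rule exE)
    have z: "length (z i) \<le> 2 * n + 2" "z i \<in> words_over X" "w i @ z i \<noteq> []"
        "cyclically_reduced (w i @ z i)"
        "\<forall>j\<in>X. odd (exponent j (w i @ z i)) \<longleftrightarrow> j = Suc i" if "i < n" for i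
      using z'[rule_format, OF that] by blast+
    define ys where "ys = map (\<lambda>i. w i @ z i) [0..<n]"
    define qs where "qs = map (\<lambda>i. (z i, d i)) [0..<n]"
    have len: "length (w i @ z i) \<le> l - 10" if "i < n" for i
    proof -
      have "length (w i) \<le> l - C" using ri(3)[OF that] by (simp add: w_def)
      then show ?thesis using z[OF that] l by (auto simp: C_def)
    qed
    have "length ys = n" by (simp add: ys_def)
    moreover have "r \<in> words_over X \<and> r \<noteq> [] \<and> cyclically_reduced r \<and> length r \<le> l - 10"
      if "r \<in> set ys" for r
    proof -
      obtain i where i: "i < n" "r = w i @ z i" using \<open>r \<in> set ys\<close> by (auto simp: ys_def)
      show ?thesis unfolding i(2) using z[OF i(1)] len[OF i(1)] wi(2)[OF i(1)] by simp
    qed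
    ultimately have "ys \<in> relator_tuples n (l - 10)" unfolding relator_tuples_def X_def by blast
    moreover have "parity_normal n ys"
      unfolding parity_normal_def
    proof (intro allI impI)
      fix i assume i: "i < n"
      show "\<forall>j\<in>{1..n+1}. odd (exponent j (ys ! i)) \<longleftrightarrow> j = Suc i"
        using z(5)[OF i] i unfolding X_def ys_def by (simp del: height_append)
    qed
    moreover have "qs \<in> Q"
    proof -
      have "(z i, d i) \<in> W \<times> W" if "i < n" for i
      proof -
        have "length (d i) \<le> C" by (simp add: d_def)
        then show ?thesis
          using z[OF that] wi(3)[OF that] by (auto simp: W_def C_def in_words_over_iff mem_Times_iff)
      qed
      then show ?thesis by (auto simp: Q_def qs_def)
    qed
    moreover have "rs = \<Phi> (ys, qs)"
    proof (rule nth_equalityI)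
      show "length rs = length (\<Phi> (ys, qs))" using rs by (simp add: \<Phi>_def relator_tuples_def)
      fix i assume "i < length rs"
      then have "i < n" using rs by (simp add: relator_tuples_def)
      then show "rs ! i = \<Phi> (ys, qs) ! i" by (simp add: \<Phi>_def ys_def qs_def wd)
    qed
    ultimately show "rs \<in> \<Phi> ` (P l \<times> Q)" unfolding P_def by blast
  qed
  moreover have "finite (P l \<times> Q)" for l
    using finQ finite_relator_tuples[of n "l - 10"] by (auto simp: P_def)
  ultimately have "card (relator_tuples n l) \<le> card (P l) * card Q" if "l \<ge> C" for l
    using surj_card_le[of "P l \<times> Q" "relator_tuples n l" \<Phi>] that by (simp add: card_cartesian_product)
  then show ?thesis unfolding P_def C_def by blast
qed

theorem theoremD:
  fixes n :: nat
  assumes "n \<ge> 1"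
  shows "limsup (\<lambda>l. ereal
           (real (card {rs \<in> relator_tuples n l. free_by_cyclic (deficiency_one_group n rs)}) /
            real (card (relator_tuples n l)))) < 1"
proof -
  obtain K where K: "\<And>l. l \<ge> 2 * n + 12 \<Longrightarrow> card (relator_tuples n l) \<le>
      card {rs \<in> relator_tuples n (l - 10). parity_normal n rs} * K"
    using card_relator_tuples_le[OF assms] by blast
  define q where "q l = real (card {rs \<in> relator_tuples n l. free_by_cyclic (deficiency_one_group n rs)}) /
            real (card (relator_tuples n l))" for l
  \<comment> \<open>At least a proportion \<open>1 / K\<close> of the tuples is bad, because
    insertion embeds \<open>P\<close> into the complement of \<open>A\<close>.\<close>
  have bound: "K > 0 \<and> q l \<le> 1 - 1 / real K" if l: "l \<ge> 2 * n + 12" for l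
  proof -
    define R where "R = relator_tuples n l"
    define A where "A = {rs \<in> R. free_by_cyclic (deficiency_one_group n rs)}"
    define P where "P = {rs \<in> relator_tuples n (l - 10). parity_normal n rs}"
    have finR: "finite R" unfolding R_def by (rule finite_relator_tuples)
    have "R \<noteq> {}" unfolding R_def using l by (intro relator_tuples_nonempty) simp
    then have Rpos: "card R > 0" using finR by (simp add: card_gt_0_iff)
    have RK: "card R \<le> card P * K" using K[OF l] by (simp add: R_def P_def)
    then have Kpos: "K > 0" using Rpos by (cases K) auto
    have "insert_tuple n ` P \<subseteq> R - A"
    proof
      fix rs assume "rs \<in> insert_tuple n ` P"
      then obtain rs' where rs': "rs = insert_tuple n rs'" "rs' \<in> relator_tuples n (l - 10)"
        "parity_normal n rs'" by (auto simp: P_def)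
      have "l - 10 + 10 = l" using l by simp
      then have "rs \<in> R" "bad_tuple n rs"
        using insert_tuple_bad[OF rs'(2,3)] by (simp_all add: rs'(1) R_def)
      then show "rs \<in> R - A"
        using bad_tuple_not_free_by_cyclic[OF assms] by (auto simp: A_def R_def)
    qed
    then have "card (insert_tuple n ` P) \<le> card (R - A)"
      using finR by (intro card_mono) auto
    moreover have "card (insert_tuple n ` P) = card P"
      unfolding P_def by (rule card_image[OF inj_on_insert_tuple])
    moreover have "card (R - A) = card R - card A" "card A \<le> card R"
      using finR by (auto simp: A_def intro!: card_Diff_subset card_mono)
    ultimately have "card A + card P \<le> card R" by simp
    then have "real (card A) \<le> real (card R) - real (card P)" by linarith
    moreover have "real (card R) / real K \<le> real (card P)"
      using RK Kpos by (simp add: divide_le_eq flip: of_nat_mult)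
    ultimately have "real (card A) \<le> (1 - 1 / real K) * real (card R)"
      by (simp add: left_diff_distrib)
    then have "real (card A) / real (card R) \<le> 1 - 1 / real K"
      using Rpos by (simp add: divide_le_eq)
    then show ?thesis using Kpos by (simp add: q_def A_def R_def)
  qed
  have "limsup (\<lambda>l. ereal (q l)) \<le> ereal (1 - 1 / real K)"
    using bound by (intro Limsup_bounded) (auto simp: eventually_sequentially)
  also have "\<dots> < 1" using bound[of "2 * n + 12"] by simp
  finally show ?thesis unfolding q_def .
qed

end
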